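(* Every partial computable random-preserving right-oneway function $f:\subseteq\{0,1\}^\omega\to\{0,1\}^\omega$ is left-oneway.
   Context: Reals are elements of $\{0,1\}^\omega$ and $\mu$ is the uniform measure. For reals $x,y$, $x\oplus y$ is the real $z$ with $z(2n)=x(n)$, $z(2n+1)=y(n)$. A partial function $f:\subseteq\{0,1\}^\omega\to\{0,1\}^\omega$ is partial computable if there is an oracle Turing functional $\Phi$ such that for every $x$: $x\in\mathrm{dom}(f)$ iff $\Phi^x(n)\downarrow$ for all $n$; and if $x\in\mathrm{dom}(f)$ then $\Phi^x(n)=f(x)(n)$ for all $n$. Random means Martin-Löf random. $f$ is random-preserving if $\mu(\mathrm{dom}(f))>0$ and $f(x)$ is random for each random $x\in\mathrm{dom}(f)$. A partial computable $f$ is left-oneway if $\mu(\mathrm{dom}(f))>0$ and $\mu(\{x\oplus r: f(g(f(x)\oplus r))=f(x)\})=0$ for each partial computable $g$. It is right-oneway if $\mu(f(\{0,1\}^\omega))>0$ and $\mu(\{y\oplus r: f(g(y\oplus r))=y\})=0$ for each partial computable $g$. Here $f(\{0,1\}^\omega)$ is the range of $f$, and equations include the assertion that all terms are defined. *)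

theory Defs
  imports "HOL-Probability.Probability"
begin

text \<open>
  Turing functionals are rendered as Kleene's partial recursive functionals: the partial recursive
  functions with the characteristic function of the parameter \<open>X\<close> as an additional initial
  function, which \<open>Query\<close> evaluates.
\<close>

datatype program =
    Zero
  | Succ
  | Proj nat
  | Query
  | Comp program "program list"
  | PrimRec program program
  | Mu program

type_synonym cantor = "nat \<Rightarrow> bool"

text \<open>\<open>computes X p ns v\<close>: program \<open>p\<close> with oracle \<open>X\<close> halts on the arguments \<open>ns\<close> with value \<open>v\<close>.\<close>

inductive computes :: "cantor \<Rightarrow> program \<Rightarrow> nat list \<Rightarrow> nat \<Rightarrow> bool" for X :: cantor where
  zero: "computes X Zero ns 0"
| succ: "computes X Succ [n] (Suc n)"
| proj: "i < length ns \<Longrightarrow> computes X (Proj i) ns (ns ! i)"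
| query: "computes X Query [n] (of_bool (X n))"
| comp: "list_all2 (\<lambda>q u. computes X q ns u) qs us \<Longrightarrow> computes X p us v
    \<Longrightarrow> computes X (Comp p qs) ns v"
| primrec_0: "computes X p ns v \<Longrightarrow> computes X (PrimRec p q) (0 # ns) v"
| primrec_Suc: "computes X (PrimRec p q) (n # ns) u \<Longrightarrow> computes X q (n # u # ns) v
    \<Longrightarrow> computes X (PrimRec p q) (Suc n # ns) v"
| mu: "computes X p (n # ns) 0 \<Longrightarrow> (\<forall>m<n. \<exists>u. computes X p (m # ns) (Suc u))
    \<Longrightarrow> computes X (Mu p) ns n"

inductive_cases computes_elims:
  "computes X Zero ns v"
  "computes X Succ ns v"
  "computes X (Proj i) ns v"
  "computes X Query ns v"
  "computes X (Comp p qs) ns v"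
  "computes X (PrimRec p q) (0 # ns) v"
  "computes X (PrimRec p q) (Suc n # ns) v"
  "computes X (Mu p) ns v"

lemma computes_unique: "computes X p ns v \<Longrightarrow> computes X p ns w \<Longrightarrow> v = w"
proof (induction arbitrary: w rule: computes.induct)
  case (comp ns qs us p v)
  from comp.prems obtain us' where us': "list_all2 (\<lambda>q u. computes X q ns u) qs us'"
      and w: "computes X p us' w"
    by (elim computes_elims)
  have "us = us'"
  proof (rule nth_equalityI)
    show "length us = length us'"
      using list_all2_lengthD[OF comp.IH(1)] list_all2_lengthD[OF us'] by (rule trans[OF sym])
    show "us ! i = us' ! i" if "i < length us" for i
    proof -
      have "i < length qs"
        using that list_all2_lengthD[OF comp.IH(1)] by (rule ord_less_eq_trans[OF _ sym])
      then show ?thesis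
        using list_all2_nthD[OF comp.IH(1)] list_all2_nthD[OF us'] by blast
    qed
  qed
  with comp.IH(2) w show ?case by blast
next
  case (primrec_Suc p q n ns u v)
  from primrec_Suc.prems obtain u' where "computes X (PrimRec p q) (n # ns) u'"
      "computes X q (n # u' # ns) w"
    by (elim computes_elims)
  with primrec_Suc.IH show ?case by blast
next
  case (mu p n ns)
  from mu.prems have w: "computes X p (w # ns) 0 \<and>
      (\<forall>m<w. \<exists>u. computes X p (m # ns) (Suc u))"
    by (rule computes_elims(8)) (rule conjI)
  show ?case
  proof (rule linorder_cases[of n w])
    assume "n < w"
    with w mu.IH(1) show ?thesis by (metis nat.distinct(1))
  next
    assume "w < n"
    with mu.IH(2) w show ?thesis by (metis nat.distinct(1))
  qed
qed (erule computes_elims; blast)+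

definition partial_computable :: "(cantor \<rightharpoonup> cantor) \<Rightarrow> bool" where
  "partial_computable f \<longleftrightarrow> (\<exists>p. \<forall>x.
     (x \<in> dom f \<longleftrightarrow> (\<forall>n. \<exists>v. computes x p [n] v)) \<and>
     (\<forall>y. f x = Some y \<longrightarrow> (\<forall>n. computes x p [n] (of_bool (y n)))))"

text \<open>
  The completion matters for the range of a partial computable function, which is analytic and
  hence measurable for the completion, but need not be a Borel set.
\<close>

definition \<mu> :: "cantor measure" where
  "\<mu> = completion (\<Pi>\<^sub>M n\<in>UNIV. uniform_count_measure UNIV)"

definition join :: "cantor \<Rightarrow> cantor \<Rightarrow> cantor"  (infixr \<open>\<oplus>\<close> 65) where
  "x \<oplus> y = (\<lambda>n. if even n then x (n div 2) else y (n div 2))"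

text \<open>
  A string \<open>\<sigma>\<close> is coded by the positive number whose binary digits, from the least significant
  one, are \<open>\<sigma>\<close> followed by a leading digit 1.
\<close>

definition string_code :: "bool list \<Rightarrow> nat" where
  "string_code \<sigma> = horner_sum of_bool 2 (\<sigma> @ [True])"

text \<open>Being c.e. is being the domain of a partial computable function (with the empty oracle).\<close>

definition uniformly_ce :: "(nat \<Rightarrow> bool list set) \<Rightarrow> bool" where
  "uniformly_ce V \<longleftrightarrow>
     (\<exists>p. \<forall>n \<sigma>. \<sigma> \<in> V n \<longleftrightarrow> (\<exists>v. computes (\<lambda>_. False) p [n, string_code \<sigma>] v))"

definition generated_open :: "bool list set \<Rightarrow> cantor set" where
  "generated_open S = {x. \<exists>k. map x [0..<k] \<in> S}"

definition martin_loef_test :: "(nat \<Rightarrow> bool list set) \<Rightarrow> bool" where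
  "martin_loef_test V \<longleftrightarrow> uniformly_ce V \<and> (\<forall>n. emeasure \<mu> (generated_open (V n)) \<le> ennreal (1 / 2 ^ n))"

definition martin_loef_random :: "cantor \<Rightarrow> bool" where
  "martin_loef_random x \<longleftrightarrow> (\<forall>V. martin_loef_test V \<longrightarrow> x \<notin> (\<Inter>n. generated_open (V n)))"

definition random_preserving :: "(cantor \<rightharpoonup> cantor) \<Rightarrow> bool" where
  "random_preserving f \<longleftrightarrow>
     emeasure \<mu> (dom f) > 0 \<and> (\<forall>x y. martin_loef_random x \<longrightarrow> f x = Some y \<longrightarrow> martin_loef_random y)"

text \<open>
  Measure zero is expressed by membership in \<^const>\<open>null_sets\<close>, since \<^const>\<open>emeasure\<close> is
  also 0 on non-measurable sets.
\<close>

definition left_oneway :: "(cantor \<rightharpoonup> cantor) \<Rightarrow> bool" where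
  "left_oneway f \<longleftrightarrow> partial_computable f \<and> emeasure \<mu> (dom f) > 0 \<and>
     (\<forall>g. partial_computable g \<longrightarrow>
       {x \<oplus> r |x r. \<exists>y z. f x = Some y \<and> g (y \<oplus> r) = Some z \<and> f z = Some y} \<in> null_sets \<mu>)"

definition right_oneway :: "(cantor \<rightharpoonup> cantor) \<Rightarrow> bool" where
  "right_oneway f \<longleftrightarrow> partial_computable f \<and> emeasure \<mu> (ran f) > 0 \<and>
     (\<forall>g. partial_computable g \<longrightarrow>
       {y \<oplus> r |y r. \<exists>z. g (y \<oplus> r) = Some z \<and> f z = Some y} \<in> null_sets \<mu>)"

end

theory Submission
  imports Defs
begin

text \<open>
  Let \<open>p\<close> be a program for \<open>f\<close> and suppose that pulling back along \<open>f\<close> keeps null sets null. Then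
  the theorem is Fubini: a right inverter \<open>g\<close> succeeds on a null set \<open>R\<close> of pairs \<open>y \<oplus> r\<close>, so almost
  every section \<open>{y. y \<oplus> r \<in> R}\<close> is null, so its preimage under \<open>f\<close> is null for almost every \<open>r\<close>,
  and this means that \<open>g\<close> also succeeds on a null set of pairs \<open>x \<oplus> r\<close>.

  It remains to see why a random-preserving \<open>f\<close> pulls null sets back to null sets
  (\<open>null_sets_result_vimage\<close>). Let \<open>\<nu> \<sigma>\<close> be the measure of the oracles on which \<open>p\<close> outputs at
  least the string \<open>\<sigma>\<close>. The ratio \<open>\<nu> \<sigma> / 2\<^sup>-\<^sup>l\<close>, where \<open>l\<close> is the length of \<open>\<sigma>\<close>, is a
  supermartingale that can be approximated computably from below, so the strings on which it exceeds
  \<open>2 ^ n\<close>, up to a factor of at most 2 in the threshold, are uniformly c.e. in \<open>n\<close> (\<open>uniformly_ce_dense_strings\<close>), and by Kolmogorov's inequality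
  they generate an open set of measure at most \<open>1 / 2 ^ n\<close> (\<open>emeasure_dense_strings\<close>). Thus they
  form a Martin-Loef test, and a random value \<open>f x\<close> has to escape it at some level \<open>n\<close>. Where it
  escapes at level \<open>n\<close>, the image measure is at most a constant times the uniform measure on
  every cylinder, hence vanishes on all null sets (\<open>null_sets_if_cylinder_bound\<close>). Since almost
  every \<open>x\<close> is random, the countably many levels cover almost all of the domain of \<open>f\<close>.

  Enumerating the test requires running \<open>p\<close> on finite pieces of oracle by a program without an oracle.
  As only one fixed \<open>p\<close> matters, no universal program is needed: the stage-bounded simulation \<open>sim p\<close>
  is shown computable by induction on \<open>p\<close>.
\<close>

section \<open>Computable functions and decidable predicates\<close>

text \<open>
  Functions of \<open>k\<close> arguments are functions on lists whose values matter only at length \<open>k\<close>. An extra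
  argument, such as a bound variable or a loop counter, is put at the front of the list.
\<close>

definition computable :: "nat \<Rightarrow> (nat list \<Rightarrow> nat) \<Rightarrow> bool" where
  "computable k F \<longleftrightarrow> (\<exists>p. \<forall>ns. length ns = k \<longrightarrow> computes (\<lambda>_. False) p ns (F ns))"

definition decidable :: "nat \<Rightarrow> (nat list \<Rightarrow> bool) \<Rightarrow> bool" where
  "decidable k P \<longleftrightarrow> computable k (\<lambda>ns. of_bool (P ns))"

lemma computable_cong:
  assumes "computable k F" "\<And>ns. length ns = k \<Longrightarrow> F ns = G ns"
  shows "computable k G"
  using assms unfolding computable_def by metis

lemma decidable_cong:
  assumes "decidable k P" "\<And>ns. length ns = k \<Longrightarrow> P ns = Q ns"
  shows "decidable k Q"
  using assms(1) unfolding decidable_def by (rule computable_cong) (simp add: assms(2))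

lemma computable_nth: "i < k \<Longrightarrow> computable k (\<lambda>ns. ns ! i)"
  unfolding computable_def by (metis computes.proj)

lemma computable_comp:
  assumes Hs: "\<forall>H\<in>set Hs. computable k H" and G: "computable (length Hs) G"
  shows "computable k (\<lambda>ns. G (map (\<lambda>H. H ns) Hs))"
proof -
  from Hs have "\<forall>H\<in>set Hs. \<exists>p. \<forall>ns. length ns = k \<longrightarrow> computes (\<lambda>_. False) p ns (H ns)"
    unfolding computable_def by blast
  then obtain h where h: "\<forall>H\<in>set Hs. \<forall>ns. length ns = k \<longrightarrow> computes (\<lambda>_. False) (h H) ns (H ns)"
    by metis
  from G obtain g where g: "\<forall>ns. length ns = length Hs \<longrightarrow> computes (\<lambda>_. False) g ns (G ns)"
    unfolding computable_def by blast
  have "computes (\<lambda>_. False) (Comp g (map h Hs)) ns (G (map (\<lambda>H. H ns) Hs))" if "length ns = k" for ns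
    using that g h by (intro computes.comp[where us = "map (\<lambda>H. H ns) Hs"])
      (auto simp: list_all2_conv_all_nth)
  then show ?thesis
    unfolding computable_def by blast
qed

lemma computable_comp_1:
  "computable k H \<Longrightarrow> computable 1 G \<Longrightarrow> computable k (\<lambda>ns. G [H ns])"
  using computable_comp[of "[H]" k G] by simp

lemma computable_Suc:
  assumes "computable k F"
  shows "computable k (\<lambda>ns. Suc (F ns))"
proof -
  have "computes (\<lambda>_. False) Succ ns (Suc (ns ! 0))" if "length ns = 1" for ns
    using that computes.succ by (auto simp: length_Suc_conv)
  then have "computable 1 (\<lambda>ns. Suc (ns ! 0))"
    unfolding computable_def by blast
  from computable_comp_1[OF assms this] show ?thesis by simp
qed

lemma computable_const: "computable k (\<lambda>_. c)"
proof (induction c)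
  case 0
  show ?case unfolding computable_def using computes.zero by blast
next
  case (Suc c)
  then show ?case by (rule computable_Suc)
qed

lemma map_nth_upt_eq_drop: "length ns = k \<Longrightarrow> map (\<lambda>i. ns ! i) [j..<k] = drop j ns"
  by (auto intro: nth_equalityI)

text \<open>
  The form of composition that rearranges the leading arguments and passes the others on unchanged.
\<close>

lemma computable_comp_drop:
  assumes "\<forall>H\<in>set Hs. computable k H" "computable (length Hs + (k - j)) G"
  shows "computable k (\<lambda>ns. G (map (\<lambda>H. H ns) Hs @ drop j ns))"
proof -
  have "computable k (\<lambda>ns. G (map (\<lambda>H. H ns) (Hs @ map (\<lambda>i ns. ns ! i) [j..<k])))"
    using assms by (intro computable_comp) (auto intro: computable_nth simp del: upt_Suc)
  then show ?thesis
    by (rule computable_cong) (simp add: o_def map_nth_upt_eq_drop)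
qed

lemma computable_rec_nat:
  assumes B: "computable k B" and P: "computable k P" and Q: "computable (k + 2) Q"
  shows "computable k (\<lambda>ns. rec_nat (P ns) (\<lambda>n u. Q (n # u # ns)) (B ns))"
proof -
  from P obtain p where p: "\<And>ns. length ns = k \<Longrightarrow> computes (\<lambda>_. False) p ns (P ns)"
    unfolding computable_def by blast
  from Q obtain q where q: "\<And>ns. length ns = k + 2 \<Longrightarrow> computes (\<lambda>_. False) q ns (Q ns)"
    unfolding computable_def by blast
  have rec: "computes (\<lambda>_. False) (PrimRec p q) (n # ns) (rec_nat (P ns) (\<lambda>n u. Q (n # u # ns)) n)"
    if "length ns = k" for n ns
  proof (induction n)
    case 0
    show ?case using p[OF that] by (simp add: computes.primrec_0)
  next
    case (Suc n)
    then show ?case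
      using q[of "n # rec_nat (P ns) (\<lambda>n u. Q (n # u # ns)) n # ns"] that
      by (auto intro: computes.primrec_Suc)
  qed
  have "computable (Suc k) (\<lambda>ns. rec_nat (P (tl ns)) (\<lambda>n u. Q (n # u # tl ns)) (hd ns))"
    unfolding computable_def using rec by (intro exI[of _ "PrimRec p q"]) (auto simp: length_Suc_conv)
  with computable_comp_drop[of "[B]" k 0] B show ?thesis by fastforce
qed

lemma computable_drop_2: "computable k F \<Longrightarrow> computable (k + 2) (\<lambda>ns. F (drop 2 ns))"
  using computable_comp_drop[of "[]" "k + 2" 2 F] by simp

lemma computable_add:
  assumes "computable k F" "computable k G"
  shows "computable k (\<lambda>ns. F ns + G ns)"
proof -
  have *: "rec_nat a (\<lambda>_ u. Suc u) n = a + n" for a n by (induction n) auto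
  have "computable k (\<lambda>ns. rec_nat (F ns) (\<lambda>n u. Suc ((n # u # ns) ! 1)) (G ns))"
    using assms by (intro computable_rec_nat computable_Suc computable_nth) auto
  then show ?thesis by (simp add: *)
qed

lemma computable_pred:
  assumes "computable k F"
  shows "computable k (\<lambda>ns. F ns - 1)"
proof -
  have *: "rec_nat 0 (\<lambda>n _. n) n = n - 1" for n by (cases n) auto
  have "computable k (\<lambda>ns. rec_nat 0 (\<lambda>n u. (n # u # ns) ! 0) (F ns))"
    using assms by (intro computable_rec_nat computable_const computable_nth) auto
  then show ?thesis by (simp add: *)
qed

lemma computable_diff:
  assumes "computable k F" "computable k G"
  shows "computable k (\<lambda>ns. F ns - G ns)"
proof -
  have *: "rec_nat a (\<lambda>_ u. u - Suc 0) n = a - n" for a n by (induction n) auto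
  have "computable k (\<lambda>ns. rec_nat (F ns) (\<lambda>n u. (n # u # ns) ! 1 - 1) (G ns))"
    using assms by (intro computable_rec_nat computable_pred computable_nth) auto
  then show ?thesis by (simp add: *)
qed

lemma computable_mult:
  assumes "computable k F" "computable k G"
  shows "computable k (\<lambda>ns. F ns * G ns)"
proof -
  have *: "rec_nat 0 (\<lambda>_ u. u + a) n = a * n" for a n :: nat by (induction n) auto
  have "computable k (\<lambda>ns. rec_nat 0 (\<lambda>n u. (n # u # ns) ! 1 + F (drop 2 (n # u # ns))) (G ns))"
    using assms by (intro computable_rec_nat computable_add computable_const computable_nth
        computable_drop_2) auto
  then show ?thesis by (simp add: *)
qed

lemma computable_power_2:
  assumes "computable k F"
  shows "computable k (\<lambda>ns. 2 ^ F ns)"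
proof -
  have *: "rec_nat 1 (\<lambda>_ u. u + u) n = (2 ^ n :: nat)" for n by (induction n) auto
  have "computable k (\<lambda>ns. rec_nat 1 (\<lambda>n u. (n # u # ns) ! 1 + (n # u # ns) ! 1) (F ns))"
    using assms by (intro computable_rec_nat computable_add computable_const computable_nth) auto
  then show ?thesis by (simp add: *[unfolded One_nat_def])
qed

lemma computable_sum:
  assumes B: "computable k B" and F: "computable (Suc k) F"
  shows "computable k (\<lambda>ns. \<Sum>a<B ns. F (a # ns))"
proof -
  have *: "rec_nat 0 (\<lambda>a u. u + h a) n = (\<Sum>a<n. h a)" for n and h :: "nat \<Rightarrow> nat"
    by (induction n) auto
  have "computable (k + 2) (\<lambda>ns. F (ns ! 0 # drop 2 ns))"
    using computable_comp_drop[of "[\<lambda>ns. ns ! 0]" "k + 2" 2 F] F by (simp add: computable_nth)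
  then have "computable k (\<lambda>ns. rec_nat 0
      (\<lambda>n u. (n # u # ns) ! 1 + F ((n # u # ns) ! 0 # drop 2 (n # u # ns))) (B ns))"
    using B by (intro computable_rec_nat computable_add computable_const computable_nth) auto
  then show ?thesis by (simp add: *)
qed

lemma decidable_eq_0:
  assumes "computable k F"
  shows "decidable k (\<lambda>ns. F ns = 0)"
  unfolding decidable_def
  using computable_diff[OF computable_const[of k 1] assms]
  by (rule computable_cong) auto

lemma decidable_not:
  assumes "decidable k P"
  shows "decidable k (\<lambda>ns. \<not> P ns)"
  using decidable_eq_0[OF assms[unfolded decidable_def]] by simp

lemma decidable_and:
  assumes "decidable k P" "decidable k Q"
  shows "decidable k (\<lambda>ns. P ns \<and> Q ns)"
  using computable_mult[OF assms[unfolded decidable_def]] unfolding decidable_def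
  by (rule computable_cong) auto

lemma decidable_imp:
  assumes "decidable k P" "decidable k Q"
  shows "decidable k (\<lambda>ns. P ns \<longrightarrow> Q ns)"
  using decidable_not[OF decidable_and[OF assms(1) decidable_not[OF assms(2)]]] by simp

lemma decidable_le:
  assumes "computable k F" "computable k G"
  shows "decidable k (\<lambda>ns. F ns \<le> G ns)"
  using decidable_eq_0[OF computable_diff[OF assms]] by simp

lemma decidable_less:
  assumes "computable k F" "computable k G"
  shows "decidable k (\<lambda>ns. F ns < G ns)"
  using decidable_le[OF computable_Suc[OF assms(1)] assms(2)] by (simp add: Suc_le_eq)

lemma decidable_eq:
  assumes "computable k F" "computable k G"
  shows "decidable k (\<lambda>ns. F ns = G ns)"
  using decidable_and[OF decidable_le[OF assms] decidable_le[OF assms(2,1)]]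
  by (simp add: order_eq_iff)

lemma decidable_all_less:
  assumes B: "computable k B" and P: "decidable (Suc k) P"
  shows "decidable k (\<lambda>ns. \<forall>a<B ns. P (a # ns))"
  using decidable_eq_0[OF computable_sum[OF B decidable_not[OF P, unfolded decidable_def]]]
  by (rule decidable_cong) auto

lemma computable_if:
  assumes "decidable k P" "computable k F" "computable k G"
  shows "computable k (\<lambda>ns. if P ns then F ns else G ns)"
  using computable_add[OF computable_mult[OF assms(1)[unfolded decidable_def] assms(2)]
      computable_mult[OF decidable_not[OF assms(1), unfolded decidable_def] assms(3)]]
  by (rule computable_cong) auto

lemma computable_mod_2:
  assumes "computable k F"
  shows "computable k (\<lambda>ns. F ns mod 2)"
proof -
  have *: "rec_nat 0 (\<lambda>_ u. Suc 0 - u) n = n mod 2" for n by (induction n) (auto simp: mod_Suc)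
  have "computable k (\<lambda>ns. rec_nat 0 (\<lambda>n u. 1 - (n # u # ns) ! 1) (F ns))"
    using assms by (intro computable_rec_nat computable_diff computable_const computable_nth) auto
  then show ?thesis by (simp add: *)
qed

text \<open>Half of a number, rounded down, is the number of odd numbers below it.\<close>

lemma computable_div_2:
  assumes "computable k F"
  shows "computable k (\<lambda>ns. F ns div 2)"
proof -
  have *: "(\<Sum>a<n. a mod 2) = n div 2" for n :: nat
  proof (induction n)
    case (Suc n)
    then show ?case unfolding sum.lessThan_Suc by presburger
  qed simp
  have "computable k (\<lambda>ns. \<Sum>a<F ns. (a # ns) ! 0 mod 2)"
    using assms by (intro computable_sum computable_mod_2 computable_nth) auto
  then show ?thesis by (simp add: *)
qed

lemma decidable_bit:
  assumes F: "computable k F" and G: "computable k G"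
  shows "decidable k (\<lambda>ns. bit (F ns) (G ns))"
proof -
  have *: "rec_nat a (\<lambda>_ u. u div 2) n = a div 2 ^ n" for a n :: nat
    by (induction n) (simp_all add: div_mult2_eq[symmetric] mult.commute)
  have "computable k (\<lambda>ns. rec_nat (F ns) (\<lambda>n u. (n # u # ns) ! 1 div 2) (G ns))"
    using assms by (intro computable_rec_nat computable_div_2 computable_nth) auto
  then have "computable k (\<lambda>ns. (F ns div 2 ^ G ns) mod 2)"
    by (intro computable_mod_2) (simp add: *)
  then show ?thesis
    unfolding decidable_def by (rule computable_cong) (auto simp: bit_iff_odd mod2_eq_if)
qed

text \<open>The program is an unbounded search for a witness, with \<^const>\<open>Mu\<close>.\<close>

lemma semidecidable_ex:
  assumes "decidable (Suc k) P"
  obtains p where "\<And>ns. length ns = k \<Longrightarrow>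
    (\<exists>v. computes (\<lambda>_. False) p ns v) \<longleftrightarrow> (\<exists>s. P (s # ns))"
proof -
  from decidable_not[OF assms] obtain q
    where q: "\<And>ns. length ns = Suc k \<Longrightarrow> computes (\<lambda>_. False) q ns (of_bool (\<not> P ns))"
    unfolding decidable_def computable_def by blast
  have "(\<exists>v. computes (\<lambda>_. False) (Mu q) ns v) \<longleftrightarrow> (\<exists>s. P (s # ns))" if k: "length ns = k" for ns
  proof
    assume "\<exists>v. computes (\<lambda>_. False) (Mu q) ns v"
    then obtain v where "computes (\<lambda>_. False) q (v # ns) 0" by (auto elim: computes_elims)
    moreover have "computes (\<lambda>_. False) q (v # ns) (of_bool (\<not> P (v # ns)))" using q k by simp
    ultimately have "(0::nat) = of_bool (\<not> P (v # ns))" by (rule computes_unique)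
    then have "P (v # ns)" by (simp split: if_splits)
    then show "\<exists>s. P (s # ns)" ..
  next
    assume ex: "\<exists>s. P (s # ns)"
    define s where "s = (LEAST s. P (s # ns))"
    from ex have "P (s # ns)" unfolding s_def by (rule LeastI_ex)
    then have "computes (\<lambda>_. False) q (s # ns) 0" using q[of "s # ns"] k by simp
    moreover have "computes (\<lambda>_. False) q (m # ns) (Suc 0)" if "m < s" for m
      using q[of "m # ns"] k not_less_Least[OF that[unfolded s_def]] by simp
    ultimately have "computes (\<lambda>_. False) (Mu q) ns s" by (blast intro: computes.mu)
    then show "\<exists>v. computes (\<lambda>_. False) (Mu q) ns v" ..
  qed
  with that show ?thesis by blast
qed

section \<open>Stage-bounded simulation of oracle programs\<close>

text \<open>
  The outcome of \<open>p\<close> at stage \<open>s\<close>, with 0 for \<open>no value yet\<close> and \<open>Suc v\<close> for the value \<open>v\<close>. Queries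
  and searches fail from \<open>s\<close> on, so that stage \<open>s\<close> sees only the first \<open>s\<close> bits of the oracle.
  For \<^const>\<open>Mu\<close>, the sum has at most one nonzero summand, at the least zero of \<open>p\<close>.
\<close>

fun sim :: "program \<Rightarrow> nat \<Rightarrow> cantor \<Rightarrow> nat list \<Rightarrow> nat" where
  "sim Zero s X ns = 1"
| "sim Succ s X ns = (if length ns = 1 then Suc (Suc (ns ! 0)) else 0)"
| "sim (Proj i) s X ns = (if i < length ns then Suc (ns ! i) else 0)"
| "sim Query s X ns = (if length ns = 1 \<and> ns ! 0 < s then Suc (of_bool (X (ns ! 0))) else 0)"
| "sim (Comp p qs) s X ns =
    (if \<forall>q\<in>set qs. sim q s X ns \<noteq> 0 then sim p s X (map (\<lambda>q. sim q s X ns - 1) qs) else 0)"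
| "sim (PrimRec p q) s X ns =
    (if ns = [] then 0
     else rec_nat (sim p s X (tl ns))
       (\<lambda>m u. if u = 0 then 0 else sim q s X (m # (u - 1) # tl ns)) (hd ns))"
| "sim (Mu p) s X ns =
    (\<Sum>n<s. of_bool (sim p s X (n # ns) = 1 \<and> (\<forall>m<n. 1 < sim p s X (m # ns))) * Suc n)"

lemma sim_Mu_eq:
  assumes "n < s" "sim p s X (n # ns) = 1" "\<forall>m<n. 1 < sim p s X (m # ns)"
  shows "sim (Mu p) s X ns = Suc n"
proof -
  have *: "(sim p s X (i # ns) = 1 \<and> (\<forall>m<i. 1 < sim p s X (m # ns))) \<longleftrightarrow> i = n" for i
  proof
    assume i: "sim p s X (i # ns) = 1 \<and> (\<forall>m<i. 1 < sim p s X (m # ns))"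
    with assms have "\<not> i < n" "\<not> n < i" by (metis less_irrefl)+
    then show "i = n" by simp
  qed (use assms in auto)
  have "sim (Mu p) s X ns = (\<Sum>i<s. if i = n then Suc n else 0)"
    unfolding sim.simps * by (rule sum.cong) auto
  with assms(1) show ?thesis by simp
qed

lemma sim_Mu_nonzero:
  assumes "sim (Mu p) s X ns = Suc v"
  shows "sim p s X (v # ns) = 1 \<and> (\<forall>m<v. 1 < sim p s X (m # ns))"
proof -
  have "\<exists>n<s. sim p s X (n # ns) = 1 \<and> (\<forall>m<n. 1 < sim p s X (m # ns))"
  proof (rule ccontr)
    assume "\<not> ?thesis"
    then have "of_bool (sim p s X (n # ns) = 1 \<and> (\<forall>m<n. 1 < sim p s X (m # ns))) = (0::nat)" if "n < s" for n
      using that by (subst of_bool_eq_0_iff) blast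
    then have "sim (Mu p) s X ns = 0" unfolding sim.simps by (intro sum.neutral) auto
    with assms show False by simp
  qed
  then obtain n where n: "n < s" "sim p s X (n # ns) = 1" "\<forall>m<n. 1 < sim p s X (m # ns)" by blast
  from sim_Mu_eq[OF n] assms have "n = v" by simp
  with n show ?thesis by simp
qed

lemma computes_if_sim: "sim p s X ns = Suc v \<Longrightarrow> computes X p ns v"
proof (induction p arbitrary: ns v)
  case Zero
  then show ?case by (auto intro: computes.zero)
next
  case Succ
  then show ?case by (auto simp: length_Suc_conv intro: computes.succ split: if_splits)
next
  case (Proj i)
  then show ?case by (auto intro: computes.proj split: if_splits)
next
  case Query
  then show ?case by (auto simp: length_Suc_conv intro: computes.query simp del: of_bool_eq split: if_splits)
next
  case (Comp p qs)
  let ?us = "map (\<lambda>q. sim q s X ns - 1) qs"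
  from Comp.prems have nz: "\<forall>q\<in>set qs. sim q s X ns \<noteq> 0" and p: "sim p s X ?us = Suc v"
    by (auto split: if_splits)
  have "list_all2 (\<lambda>q u. computes X q ns u) qs ?us"
    using nz Comp.IH(2) by (auto simp: list_all2_conv_all_nth)
  with Comp.IH(1)[OF p] show ?case by (rule computes.comp[rotated])
next
  case (PrimRec p q)
  then obtain n ms where ns: "ns = n # ms" by (cases ns) auto
  have "rec_nat (sim p s X ms) (\<lambda>m u. if u = 0 then 0 else sim q s X (m # (u - 1) # ms)) n = Suc v
    \<Longrightarrow> computes X (PrimRec p q) (n # ms) v"
  proof (induction n arbitrary: v)
    case 0
    then show ?case using PrimRec.IH(1) by (auto intro: computes.primrec_0)
  next
    case (Suc n)
    then obtain u where
        u: "rec_nat (sim p s X ms) (\<lambda>m u. if u = 0 then 0 else sim q s X (m # (u - 1) # ms)) n = Suc u"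
      by (cases "rec_nat (sim p s X ms) (\<lambda>m u. if u = 0 then 0 else sim q s X (m # (u - 1) # ms)) n") auto
    with Suc.prems have "sim q s X (n # u # ms) = Suc v" by simp
    with Suc.IH[OF u] PrimRec.IH(2) show ?case by (blast intro: computes.primrec_Suc)
  qed
  with PrimRec.prems ns show ?case by (simp cong: if_cong)
next
  case (Mu p)
  from sim_Mu_nonzero[OF Mu.prems] have v: "sim p s X (v # ns) = Suc 0"
    and m: "\<And>m. m < v \<Longrightarrow> 1 < sim p s X (m # ns)"
    by simp_all
  have "\<exists>u. computes X p (m # ns) (Suc u)" if "m < v" for m
  proof -
    from m[OF that] have "sim p s X (m # ns) = Suc (Suc (sim p s X (m # ns) - 2))" by simp
    then show ?thesis using Mu.IH by blast
  qed
  with Mu.IH[OF v] show ?case by (blast intro: computes.mu)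
qed

text \<open>
  A halting computation asks finitely many queries and makes finitely many finite searches, so it
  succeeds at all sufficiently late stages.
\<close>

lemma sim_if_computes: "computes X p ns v \<Longrightarrow> \<forall>\<^sub>F s in sequentially. sim p s X ns = Suc v"
proof (induction rule: computes.induct)
  case (query n)
  show ?case using eventually_gt_at_top[of n] by eventually_elim simp
next
  case (comp ns qs us p v)
  have len: "length qs = length us" using comp.IH(1) by (rule list_all2_lengthD)
  have "\<forall>\<^sub>F s in sequentially. \<forall>i\<in>{..<length qs}. sim (qs ! i) s X ns = Suc (us ! i)"
    using comp.IH(1) by (intro eventually_ball_finite) (auto simp: list_all2_conv_all_nth)
  with comp.IH(2) show ?case
  proof eventually_elim
    case (elim s)
    then have "map (\<lambda>q. sim q s X ns - 1) qs = us" using len by (auto intro: nth_equalityI)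
    moreover have "\<forall>q\<in>set qs. sim q s X ns \<noteq> 0" using elim by (auto simp: in_set_conv_nth)
    ultimately show ?case using elim by simp
  qed
next
  case (primrec_Suc p q n ns u v)
  from primrec_Suc.IH show ?case by eventually_elim (simp cong: if_cong)
next
  case (mu p n ns)
  have "\<forall>\<^sub>F s in sequentially. \<forall>m\<in>{..<n}. 1 < sim p s X (m # ns)"
  proof (intro eventually_ball_finite ballI)
    fix m assume "m \<in> {..<n}"
    then obtain u where "\<forall>\<^sub>F s in sequentially. sim p s X (m # ns) = Suc (Suc u)"
      using mu.IH by auto
    then show "\<forall>\<^sub>F s in sequentially. 1 < sim p s X (m # ns)" by eventually_elim simp
  qed simp
  with mu.IH(1) eventually_gt_at_top[of n] show ?case
  proof eventually_elim
    case (elim s)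
    then show ?case by (intro sim_Mu_eq) auto
  qed
qed auto

lemma sim_cong: "(\<And>i. i < s \<Longrightarrow> X i = Y i) \<Longrightarrow> sim p s X ns = sim p s Y ns"
proof (induction p arbitrary: ns)
  case (Comp p qs)
  then have "sim q s X ns = sim q s Y ns" if "q \<in> set qs" for q using that by blast
  then have "map (\<lambda>q. sim q s X ns - 1) qs = map (\<lambda>q. sim q s Y ns - 1) qs"
    "(\<forall>q\<in>set qs. sim q s X ns \<noteq> 0) = (\<forall>q\<in>set qs. sim q s Y ns \<noteq> 0)" by auto
  then show ?case using Comp.IH(1)[OF Comp.prems] by (simp only: sim.simps)
qed (auto cong: if_cong)

lemma computable_sim_comp:
  assumes sim: "computable (length Hs + (k - j) + 2) (\<lambda>ns. sim p (ns ! 0) (bit (ns ! 1)) (drop 2 ns))"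
    and "computable k S" "computable k A" "\<forall>H\<in>set Hs. computable k H"
  shows "computable k (\<lambda>ns. sim p (S ns) (bit (A ns)) (map (\<lambda>H. H ns) Hs @ drop j ns))"
  using computable_comp_drop[of "S # A # Hs" k j "\<lambda>ns. sim p (ns ! 0) (bit (ns ! 1)) (drop 2 ns)"] assms
  by auto

text \<open>
  The oracle is passed as a number whose binary digits are its values. By recursion on \<open>p\<close>, the
  simulation is put together from primitive recursions and bounded sums.
\<close>

lemma computable_sim: "computable (k + 2) (\<lambda>ns. sim p (ns ! 0) (bit (ns ! 1)) (drop 2 ns))"
proof (induction p arbitrary: k)
  case Zero
  show ?case by (simp add: computable_const)
next
  case Succ
  have "computable (k + 2) (\<lambda>ns. if k = 1 then Suc (Suc (ns ! 2)) else 0)"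
    by (cases "k = 1") (auto intro!: computable_Suc computable_nth computable_const)
  then show ?case by (rule computable_cong) auto
next
  case (Proj i)
  have "computable (k + 2) (\<lambda>ns. if i < k then Suc (ns ! (2 + i)) else 0)"
    by (cases "i < k") (auto intro!: computable_Suc computable_nth computable_const)
  then show ?case by (rule computable_cong) auto
next
  case Query
  have "computable (k + 2) (\<lambda>ns. if k = 1 then if ns ! 2 < ns ! 0
      then Suc (of_bool (bit (ns ! 1) (ns ! 2))) else 0 else 0)"
    by (cases "k = 1") (auto intro!: computable_Suc computable_nth computable_const computable_if
        decidable_less decidable_bit[unfolded decidable_def])
  then show ?case by (rule computable_cong) auto
next
  case (Comp p qs)
  let ?sim = "\<lambda>q ns. sim q (ns ! 0) (bit (ns ! 1)) (drop 2 ns)"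
  let ?Hs = "(\<lambda>ns. ns ! 0) # (\<lambda>ns. ns ! 1) # map (\<lambda>q ns. ?sim q ns - 1) qs"
  have "computable (k + 2) (\<lambda>ns. ?sim p (map (\<lambda>H. H ns) ?Hs))"
    using Comp.IH(1)[of "length qs"] Comp.IH(2)[of _ k]
    by (intro computable_comp) (auto intro!: computable_nth computable_pred[unfolded One_nat_def])
  moreover have "decidable (k + 2) (\<lambda>ns. \<forall>q\<in>set qs. ?sim q ns \<noteq> 0)"
    using Comp.IH(2)[of _ k]
  proof (induction qs)
    case Nil
    show ?case by (simp add: decidable_def computable_const)
  next
    case (Cons q qs)
    then have "decidable (k + 2) (\<lambda>ns. \<forall>q\<in>set qs. ?sim q ns \<noteq> 0)" by simp
    moreover have "decidable (k + 2) (\<lambda>ns. ?sim q ns \<noteq> 0)"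
      using Cons.prems by (intro decidable_not decidable_eq_0) simp
    ultimately show ?case using decidable_and by simp
  qed
  ultimately have "computable (k + 2) (\<lambda>ns. if \<forall>q\<in>set qs. ?sim q ns \<noteq> 0
      then ?sim p (map (\<lambda>H. H ns) ?Hs) else 0)"
    by (intro computable_if computable_const)
  then show ?case by (rule computable_cong) (auto simp: o_def)
next
  case (PrimRec p q)
  show ?case
  proof (cases k)
    case 0
    then show ?thesis by (intro computable_cong[OF computable_const[of _ 0]]) auto
  next
    case (Suc j)
    let ?P = "\<lambda>ns. sim p (ns ! 0) (bit (ns ! 1)) (drop 3 ns)"
    let ?Q = "\<lambda>ns. if ns ! 1 = 0 then 0
      else sim q (ns ! 2) (bit (ns ! 3)) (ns ! 0 # (ns ! 1 - 1) # drop 5 ns)"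
    have P: "computable (k + 2) ?P"
      using computable_sim_comp[of "[]" "k + 2" 3 p "\<lambda>ns. ns ! 0" "\<lambda>ns. ns ! 1"]
        PrimRec.IH(1)[of j] Suc by (simp add: computable_nth)
    have "computable (k + 4) (\<lambda>ns. sim q (ns ! 2) (bit (ns ! 3)) (ns ! 0 # (ns ! 1 - 1) # drop 5 ns))"
      using computable_sim_comp[of "[\<lambda>ns. ns ! 0, \<lambda>ns. ns ! 1 - 1]" "k + 4" 5 q "\<lambda>ns. ns ! 2" "\<lambda>ns. ns ! 3"]
        PrimRec.IH(2)[of "k + 1"] Suc computable_pred[OF computable_nth[of 1 "k + 4"]]
      by (simp add: computable_nth)
    then have Q: "computable (k + 2 + 2) ?Q"
      by (intro computable_if decidable_eq_0 computable_const computable_nth) (simp_all add: numeral_eq_Suc)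
    have "computable (k + 2) (\<lambda>ns. rec_nat (?P ns) (\<lambda>n u. ?Q (n # u # ns)) (ns ! 2))"
      using Suc P Q by (intro computable_rec_nat computable_nth) auto
    then show ?thesis
    proof (rule computable_cong)
      fix ns :: "nat list" assume "length ns = k + 2"
      then obtain s a n ms where "ns = s # a # n # ms"
        using Suc by (auto simp: length_Suc_conv)
      then show "rec_nat (?P ns) (\<lambda>n u. ?Q (n # u # ns)) (ns ! 2)
          = sim (PrimRec p q) (ns ! 0) (bit (ns ! 1)) (drop 2 ns)"
        by (simp add: numeral_eq_Suc cong: if_cong)
    qed
  qed
next
  case (Mu p)
  let ?P = "\<lambda>ns. sim p (ns ! 1) (bit (ns ! 2)) (ns ! 0 # drop 3 ns)"
  let ?Q = "\<lambda>ns. sim p (ns ! 2) (bit (ns ! 3)) (ns ! 0 # drop 4 ns)"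
  have P: "computable (Suc (k + 2)) ?P"
    using computable_sim_comp[of "[\<lambda>ns. ns ! 0]" "k + 3" 3 p "\<lambda>ns. ns ! 1" "\<lambda>ns. ns ! 2"]
      Mu.IH[of "k + 1"] by (simp add: computable_nth numeral_3_eq_3)
  have Q: "computable (Suc (Suc (k + 2))) ?Q"
    using computable_sim_comp[of "[\<lambda>ns. ns ! 0]" "k + 4" 4 p "\<lambda>ns. ns ! 2" "\<lambda>ns. ns ! 3"]
      Mu.IH[of "k + 1"] by (simp add: computable_nth numeral_eq_Suc)
  have "computable (k + 2) (\<lambda>ns. \<Sum>n<ns ! 0. of_bool (?P (n # ns) = 1 \<and>
      (\<forall>m<(n # ns) ! 0. 1 < ?Q (m # n # ns))) * Suc ((n # ns) ! 0))"
    using P Q by (intro computable_sum computable_mult computable_Suc computable_nth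
        decidable_and[unfolded decidable_def] decidable_eq[unfolded decidable_def]
        decidable_all_less[unfolded decidable_def] decidable_less[unfolded decidable_def]
        computable_const) auto
  then show ?case
    by (rule computable_cong) (simp add: numeral_eq_Suc)
qed

section \<open>The uniform measure\<close>

text \<open>
  The uniform measure before its completion, so that the measurable sets are generated by cylinders.
\<close>

abbreviation coin :: "cantor measure" where
  "coin \<equiv> \<Pi>\<^sub>M n\<in>UNIV. uniform_count_measure UNIV"

interpretation coin: product_prob_space "\<lambda>_::nat. uniform_count_measure (UNIV :: bool set)" UNIV
  by (intro product_prob_spaceI prob_space_uniform_count_measure) auto

lemma space_coin [simp]: "space coin = UNIV"
  by (simp add: space_PiM space_uniform_count_measure PiE_UNIV_domain)

definition cylinder :: "nat \<Rightarrow> cantor \<Rightarrow> cantor set" where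
  "cylinder k y = {x. \<forall>i<k. x i = y i}"

lemma emeasure_cylinder: "emeasure coin (cylinder k y) = ennreal (1 / 2 ^ k)"
proof -
  have "emeasure coin (cylinder k y) = (\<Prod>i<k. emeasure (uniform_count_measure (UNIV :: bool set)) {y i})"
    using coin.emeasure_PiM_Collect[of "{..<k}" "\<lambda>i. {y i}"] by (simp add: cylinder_def Ball_def)
  also have "\<dots> = (\<Prod>i<k. ennreal (1 / 2))"
    by (intro prod.cong) (simp_all add: emeasure_uniform_count_measure)
  also have "\<dots> = ennreal (1 / 2 ^ k)"
    by (subst prod_ennreal) (simp_all add: power_one_over)
  finally show ?thesis .
qed

lemma sets_cylinder [measurable]: "cylinder k y \<in> sets coin"
proof -
  have "{x \<in> space coin. x i \<in> {y i}} \<in> sets coin" for i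
    by (rule measurable_sets_Collect[OF measurable_component_singleton])
      (auto simp: sets_uniform_count_measure)
  then have "{x \<in> space coin. \<forall>i\<in>{..<k}. x i \<in> {y i}} \<in> sets coin"
    by (intro sets.sets_Collect_finite_All) auto
  then show ?thesis by (simp add: cylinder_def Ball_def)
qed

text \<open>The sets for which there is such a \<open>k\<close> are the clopen sets.\<close>

definition finitary :: "nat \<Rightarrow> cantor set \<Rightarrow> bool" where
  "finitary k A \<longleftrightarrow> (\<forall>x y. (\<forall>i<k. x i = y i) \<longrightarrow> x \<in> A \<longrightarrow> y \<in> A)"

lemma finitaryD:
  assumes "finitary k A" "\<And>i. i < k \<Longrightarrow> x i = y i"
  shows "x \<in> A \<longleftrightarrow> y \<in> A"
proof
  have "\<forall>i<k. x i = y i" using assms(2) by simp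
  then show "x \<in> A \<Longrightarrow> y \<in> A" using assms(1) unfolding finitary_def by simp
  have "\<forall>i<k. y i = x i" using assms(2) by simp
  then show "y \<in> A \<Longrightarrow> x \<in> A" using assms(1) unfolding finitary_def by simp
qed

lemma finitary_mono:
  assumes "finitary k A" "k \<le> l"
  shows "finitary l A"
  unfolding finitary_def
proof (intro allI impI)
  fix x y assume "\<forall>i<l. x i = y i" "x \<in> A"
  with assms(2) finitaryD[OF assms(1), of x y] show "y \<in> A" by simp
qed

lemma finitary_Compl:
  assumes "finitary k A"
  shows "finitary k (- A)"
  unfolding finitary_def
proof (intro allI impI)
  fix x y assume "\<forall>i<k. x i = y i" "x \<in> - A"
  with finitaryD[OF assms, of x y] show "y \<in> - A" by simp
qed

lemma finitary_UN:
  assumes "\<And>i. i \<in> I \<Longrightarrow> finitary k (A i)"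
  shows "finitary k (\<Union>i\<in>I. A i)"
  unfolding finitary_def
proof (intro allI impI)
  fix x y assume eq: "\<forall>i<k. x i = y i" and "x \<in> (\<Union>i\<in>I. A i)"
  then obtain i where "i \<in> I" "x \<in> A i" by blast
  with finitaryD[OF assms, of i x y] eq show "y \<in> (\<Union>i\<in>I. A i)" by auto
qed

lemma finitary_eq_UN_cylinder:
  assumes "finitary k A"
  shows "A = (\<Union>a\<in>{a :: nat. a < 2 ^ k \<and> bit a \<in> A}. cylinder k (bit a))"
proof (intro equalityI subsetI)
  fix x assume x: "x \<in> A"
  define a :: nat where "a = horner_sum of_bool 2 (map x [0..<k])"
  have bit: "bit a i \<longleftrightarrow> x i" if "i < k" for i
    using that by (simp add: a_def bit_horner_sum_bit_iff)
  have "a < 2 ^ k"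
    unfolding a_def using horner_sum_of_bool_2_less[of "map x [0..<k]"] by simp
  moreover have "bit a \<in> A"
    using x finitaryD[OF assms, of x "bit a"] bit by blast
  moreover have "x \<in> cylinder k (bit a)"
    using bit by (simp add: cylinder_def)
  ultimately show "x \<in> (\<Union>a\<in>{a :: nat. a < 2 ^ k \<and> bit a \<in> A}. cylinder k (bit a))" by blast
next
  fix x assume "x \<in> (\<Union>a\<in>{a :: nat. a < 2 ^ k \<and> bit a \<in> A}. cylinder k (bit a))"
  then obtain a :: nat where "bit a \<in> A" "x \<in> cylinder k (bit a)" by blast
  then show "x \<in> A" using finitaryD[OF assms, of x "bit a"] by (simp add: cylinder_def)
qed

lemma disjoint_cylinders: "disjoint_family_on (\<lambda>a::nat. cylinder k (bit a)) {a. a < 2 ^ k \<and> P a}"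
proof -
  have "a = b" if "a < 2 ^ k" "b < 2 ^ k" "x \<in> cylinder k (bit a)" "x \<in> cylinder k (bit b)" for a b :: nat and x
  proof -
    have "take_bit k a = take_bit k b"
      using that(3,4) by (intro bit_eqI) (auto simp: cylinder_def bit_simps)
    with that(1,2) show ?thesis by (simp add: take_bit_nat_eq_self)
  qed
  then show ?thesis unfolding disjoint_family_on_def
    by (intro ballI impI equals0I) (auto simp: Int_iff)
qed

lemma sets_finitary: "finitary k A \<Longrightarrow> A \<in> sets coin"
  by (subst finitary_eq_UN_cylinder) (auto intro: sets_cylinder)

lemma emeasure_finitary:
  assumes "finitary k A" "sets N = sets coin"
  shows "emeasure N A = (\<Sum>a :: nat | a < 2 ^ k \<and> bit a \<in> A. emeasure N (cylinder k (bit a)))"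
  using assms(2) by (subst finitary_eq_UN_cylinder[OF assms(1)])
    (intro sum_emeasure[symmetric] disjoint_cylinders; auto intro: sets_cylinder)

text \<open>Counting the strings of length \<open>k\<close>, coded as numbers below \<open>2 ^ k\<close>, makes the measure computable.\<close>

lemma measure_finitary:
  assumes "finitary k A"
  shows "measure coin A = real (card {a :: nat. a < 2 ^ k \<and> bit a \<in> A}) / 2 ^ k"
proof -
  have "emeasure coin A = (\<Sum>a :: nat | a < 2 ^ k \<and> bit a \<in> A. ennreal (1 / 2 ^ k))"
    unfolding emeasure_finitary[OF assms refl] by (simp add: emeasure_cylinder)
  also have "\<dots> = ennreal (real (card {a :: nat. a < 2 ^ k \<and> bit a \<in> A}) / 2 ^ k)"
    by (simp add: ennreal_of_nat_eq_real_of_nat ennreal_mult'[symmetric])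
  finally show ?thesis by (simp add: measure_def)
qed

lemma sets_coin_eq: "sets coin = sigma_sets UNIV {A. \<exists>k. finitary k A}"
proof
  have "{x \<in> UNIV. x i \<in> A} \<in> sigma_sets UNIV {A. \<exists>k. finitary k A}" for i and A :: "bool set"
    by (rule sigma_sets.Basic) (auto simp: finitary_def intro!: exI[of _ "Suc i"])
  then show "sets coin \<subseteq> sigma_sets UNIV {A. \<exists>k. finitary k A}"
    by (auto simp: sets_PiM_single space_uniform_count_measure PiE_UNIV_domain
        intro!: sigma_sets_mono)
  show "sigma_sets UNIV {A. \<exists>k. finitary k A} \<subseteq> sets coin"
    using sets.sigma_sets_subset[of "{A. \<exists>k. finitary k A}" coin] sets_finitary by auto
qed

text \<open>
  The clopen sets form an algebra that generates the Borel sets, so they are dense in the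
  Borel sets for the measure of the symmetric difference. The approximation is needed
  for two measures at the same time, hence the finite set of measures.
\<close>

lemma finitary_approximation:
  assumes A: "A \<in> sets coin" and e: "0 < (e :: real)"
    and Ms: "finite Ms" "\<And>M. M \<in> Ms \<Longrightarrow> finite_measure M \<and> sets M = sets coin"
  shows "\<exists>k E. finitary k E \<and> (\<forall>M\<in>Ms. measure M (sym_diff A E) < e)"
  using A[unfolded sets_coin_eq] e
proof (induction arbitrary: e rule: sigma_sets.induct)
  case (Basic A)
  then obtain k where "finitary k A" by blast
  with Basic show ?case by (intro exI[of _ k] exI[of _ A]) auto
next
  case Empty
  then show ?case by (intro exI[of _ 0] exI[of _ "{}"]) (auto simp: finitary_def)
next
  case (Compl A)
  then obtain k E where kE: "finitary k E" "\<forall>M\<in>Ms. measure M (sym_diff A E) < e" by blast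
  have "sym_diff (UNIV - A) (- E) = sym_diff A E" by blast
  with kE finitary_Compl show ?case by metis
next
  case (Union A)
  have A: "A i \<in> sets coin" for i using Union(1) by (simp add: sets_coin_eq)
  \<comment> \<open>Half of the error goes to cutting the union off at \<open>n\<close>, half to approximating the remaining sets.\<close>
  let ?U = "\<lambda>n. \<Union>i<n. A i"
  have "\<forall>\<^sub>F n in sequentially. \<forall>M\<in>Ms. measure M ((\<Union>i. A i) - ?U n) < e / 2"
  proof (intro eventually_ball_finite Ms(1) ballI)
    fix M assume M: "M \<in> Ms"
    then interpret M: finite_measure M using Ms(2) by blast
    have [measurable]: "A i \<in> sets M" for i using A Ms(2)[OF M] by simp
    have "(\<lambda>n. measure M ((\<Union>i. A i) - ?U n)) \<longlonglongrightarrow> measure M (\<Inter>n. (\<Union>i. A i) - ?U n)"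
      by (intro M.finite_Lim_measure_decseq) (auto simp: decseq_def intro: order_less_le_trans)
    also have "(\<Inter>n. (\<Union>i. A i) - ?U n) = {}" by blast
    finally have "(\<lambda>n. measure M ((\<Union>i. A i) - ?U n)) \<longlonglongrightarrow> 0" by simp
    with Union(3) show "\<forall>\<^sub>F n in sequentially. measure M ((\<Union>i. A i) - ?U n) < e / 2"
      by (intro order_tendstoD(2)) auto
  qed
  then obtain n where n: "\<forall>M\<in>Ms. measure M ((\<Union>i. A i) - ?U n) < e / 2"
    by (auto simp: eventually_sequentially)
  have "\<forall>i. \<exists>k E. finitary k E \<and> (\<forall>M\<in>Ms. measure M (sym_diff (A i) E) < e / (2 * Suc n))"
    using Union(2,3) by simp
  then obtain k E where E: "\<And>i. finitary (k i) (E i)"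
    "\<And>i M. M \<in> Ms \<Longrightarrow> measure M (sym_diff (A i) (E i)) < e / (2 * Suc n)" by metis
  let ?E = "\<Union>i<n. E i"
  have "finitary (Max (k ` {..<n})) ?E"
    using E(1) by (intro finitary_UN) (auto intro: finitary_mono Max_ge)
  moreover have "measure M (sym_diff (\<Union>i. A i) ?E) < e" if M: "M \<in> Ms" for M
  proof -
    interpret M: finite_measure M using Ms(2)[OF M] by blast
    have [measurable]: "A i \<in> sets M" "E i \<in> sets M" for i
      using A E(1) sets_finitary Ms(2)[OF M] by auto
    have "measure M (sym_diff (\<Union>i. A i) ?E)
        \<le> measure M (((\<Union>i. A i) - ?U n) \<union> (\<Union>i<n. sym_diff (A i) (E i)))"
      by (intro M.finite_measure_mono) auto
    also have "\<dots> \<le> measure M ((\<Union>i. A i) - ?U n) + measure M (\<Union>i<n. sym_diff (A i) (E i))"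
      by (intro measure_Un_le) auto
    also have "measure M (\<Union>i<n. sym_diff (A i) (E i)) \<le> (\<Sum>i<n. measure M (sym_diff (A i) (E i)))"
      by (intro M.finite_measure_subadditive_finite) auto
    also have "\<dots> \<le> (\<Sum>i<n. e / (2 * Suc n))"
      using E(2)[OF M] by (intro sum_mono less_imp_le) auto
    also have "\<dots> \<le> e / 2"
      using Union(3) by (simp add: field_simps)
    finally show ?thesis using n M by fastforce
  qed
  ultimately show ?case by blast
qed

text \<open>
  The bound passes from cylinders to their finite disjoint unions, the clopen sets. A null set
  is approximated in both measures by one clopen set \<open>E\<close>, whose uniform measure is then small, so
  that its measure under \<open>N\<close> is small too.
\<close>

lemma null_sets_if_cylinder_bound:
  assumes N: "finite_measure N" "sets N = sets coin"
    and le: "\<And>k y. measure N (cylinder k y) \<le> c * measure coin (cylinder k y)"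
    and A: "A \<in> null_sets coin"
  shows "A \<in> null_sets N"
proof -
  interpret N: finite_measure N by fact
  have c: "0 \<le> c"
  proof -
    have "0 \<le> c * measure coin (cylinder 0 undefined)"
      using le order_trans[OF measure_nonneg] by blast
    then show ?thesis by (simp add: measure_def emeasure_cylinder)
  qed
  have finitary_le: "measure N E \<le> c * measure coin E" if E: "finitary k E" for k E
  proof -
    have sum: "measure M E = (\<Sum>a :: nat | a < 2 ^ k \<and> bit a \<in> E. measure M (cylinder k (bit a)))"
      if "finite_measure M" "sets M = sets coin" for M
    proof -
      interpret M: finite_measure M by fact
      show ?thesis
        using that(2) by (subst finitary_eq_UN_cylinder[OF E])
          (intro M.finite_measure_finite_Union disjoint_cylinders; auto intro: sets_cylinder)
    qed
    show ?thesis
      unfolding sum[OF N] sum[OF coin.P.finite_measure_axioms refl] sum_distrib_left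
      by (intro sum_mono le)
  qed
  have [measurable]: "A \<in> sets coin" "A \<in> sets N" using A N(2) by auto
  have "measure N A \<le> 0 + e" if e: "0 < e" for e
  proof -
    define d where "d = e / (2 * (c + 1))"
    have d: "0 < d" using e c by (simp add: d_def)
    obtain k E where E: "finitary k E" "\<forall>M\<in>{N, coin}. measure M (sym_diff A E) < d"
    proof -
      have "\<exists>k E. finitary k E \<and> (\<forall>M\<in>{N, coin}. measure M (sym_diff A E) < d)"
      proof (rule finitary_approximation[OF \<open>A \<in> sets coin\<close> d])
        fix M assume "M \<in> {N, coin}"
        with N coin.P.finite_measure_axioms show "finite_measure M \<and> sets M = sets coin"
          by (elim insertE) auto
      qed simp
      with that show ?thesis by blast
    qed
    have [measurable]: "E \<in> sets coin" "E \<in> sets N" using sets_finitary[OF E(1)] N(2) by auto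
    have "measure coin E \<le> measure coin (A \<union> sym_diff A E)"
      by (intro coin.P.finite_measure_mono) auto
    also have "\<dots> \<le> measure coin A + measure coin (sym_diff A E)"
      by (intro measure_Un_le) auto
    also have "measure coin A = 0" using A by (simp add: measure_def null_setsD1)
    finally have coin: "measure coin E \<le> d" using E(2) by auto
    have "measure N A \<le> measure N (E \<union> sym_diff A E)"
      by (intro N.finite_measure_mono) auto
    also have "\<dots> \<le> measure N E + measure N (sym_diff A E)"
      by (intro measure_Un_le) auto
    also have "\<dots> \<le> c * d + d"
      using finitary_le[OF E(1)] mult_left_mono[OF coin c] E(2) by fastforce
    also have "\<dots> = (c + 1) * d" by (simp add: algebra_simps)
    also have "\<dots> = e / 2" using c by (simp add: d_def divide_simps)
    finally show ?thesis using e by simp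
  qed
  then have "measure N A = 0"
    using field_le_epsilon[of "measure N A" 0] measure_nonneg[of N A] by simp
  then show ?thesis
    using N.emeasure_eq_measure by (simp add: null_sets_def)
qed

section \<open>The function computed by a program\<close>

lemma sets_computes [measurable]: "{x. computes x p ns v} \<in> sets coin"
proof -
  have "{x. computes x p ns v} = (\<Union>s. {x. sim p s x ns = Suc v})"
    using computes_if_sim sim_if_computes by (fastforce simp: eventually_sequentially)
  moreover have "finitary s {x. sim p s x ns = Suc v}" for s
    unfolding finitary_def using sim_cong by (metis mem_Collect_eq)
  ultimately show ?thesis using sets_finitary by auto
qed

definition domain_of :: "program \<Rightarrow> cantor set" where
  "domain_of p = {x. \<forall>n. \<exists>v. computes x p [n] v}"

definition result :: "program \<Rightarrow> cantor \<Rightarrow> cantor" where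
  "result p x = (\<lambda>n. computes x p [n] 1)"

lemma sets_domain_of [measurable]: "domain_of p \<in> sets coin"
proof -
  have "domain_of p = (\<Inter>n. \<Union>v. {x. computes x p [n] v})" by (auto simp: domain_of_def)
  then show ?thesis by simp
qed

lemma measurable_result [measurable]: "result p \<in> coin \<rightarrow>\<^sub>M coin"
proof -
  have "(\<lambda>x. computes x p [n] 1) \<in> coin \<rightarrow>\<^sub>M uniform_count_measure UNIV" for n
  proof -
    have "Measurable.pred coin (\<lambda>x. computes x p [n] 1)"
      using sets_computes by (simp add: pred_def)
    then show ?thesis
      by (simp add: measurable_cong_sets[OF refl sets_uniform_count_measure_count_space])
  qed
  then show ?thesis
    unfolding result_def by (intro measurable_PiM_single') (auto simp: space_uniform_count_measure)
qed

text \<open>The oracles on which \<open>p\<close> outputs at least the first \<open>k\<close> bits of \<open>y\<close>.\<close>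

definition fibre :: "program \<Rightarrow> nat \<Rightarrow> cantor \<Rightarrow> cantor set" where
  "fibre p k y = {x. \<forall>i<k. computes x p [i] (of_bool (y i))}"

lemma sets_fibre [measurable]: "fibre p k y \<in> sets coin"
proof -
  have "{x \<in> space coin. \<forall>i\<in>{..<k}. computes x p [i] (of_bool (y i))} \<in> sets coin"
    using sets_computes by (intro sets.sets_Collect_finite_All) simp_all
  then show ?thesis
    by (simp add: fibre_def Ball_def split del: split_of_bool)
qed

section \<open>The test given by a program\<close>

text \<open>
  The strings to which \<open>p\<close> maps more than their share of oracles. As the code of \<open>\<sigma>\<close> is at least
  \<open>2 ^ length \<sigma>\<close> and less than twice that, it replaces this power, which spares the
  enumeration the computation of the length; the exponent \<open>Suc n\<close> makes up for the factor 2.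
\<close>

definition dense_strings :: "program \<Rightarrow> nat \<Rightarrow> bool list set" where
  "dense_strings p n =
    {\<sigma>. 2 ^ Suc n < measure coin (fibre p (length \<sigma>) (\<lambda>i. \<sigma> ! i)) * real (string_code \<sigma>)}"

lemma bit_string_code: "i < length \<sigma> \<Longrightarrow> bit (string_code \<sigma>) i = \<sigma> ! i"
  by (simp add: string_code_def bit_horner_sum_bit_iff nth_append)

lemma string_code_bounds: "2 ^ length \<sigma> \<le> string_code \<sigma>" "string_code \<sigma> < 2 ^ Suc (length \<sigma>)"
proof -
  have "string_code \<sigma> = horner_sum of_bool 2 \<sigma> + 2 ^ length \<sigma>"
    by (simp add: string_code_def horner_sum_append)
  moreover have "horner_sum of_bool 2 \<sigma> < (2 ^ length \<sigma> :: nat)"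
    by (rule horner_sum_of_bool_2_less)
  ultimately show "2 ^ length \<sigma> \<le> string_code \<sigma>" "string_code \<sigma> < 2 ^ Suc (length \<sigma>)"
    by simp_all
qed

definition fibre_at :: "program \<Rightarrow> nat \<Rightarrow> nat \<Rightarrow> cantor \<Rightarrow> cantor set" where
  "fibre_at p s k y = {x. \<forall>i<k. sim p s x [i] = Suc (of_bool (y i))}"

lemma finitary_fibre_at: "finitary s (fibre_at p s k y)"
proof -
  have "sim p s x [i] = sim p s x' [i]" if "\<forall>i<s. x i = x' i" for x x' i
    using that by (intro sim_cong) auto
  then show ?thesis unfolding finitary_def fibre_at_def mem_Collect_eq by metis
qed

text \<open>
  An oracle in the fibre lies in \<^const>\<open>fibre_at\<close> from some stage on, so the fibre is the increasing
  union of the sets \<open>?F t\<close> of those oracles that lie in it at all stages from \<open>t\<close> on.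
\<close>

lemma less_measure_fibre_iff:
  "c < measure coin (fibre p k y) \<longleftrightarrow> (\<exists>s. c < measure coin (fibre_at p s k y))"
proof
  assume c: "c < measure coin (fibre p k y)"
  let ?F = "\<lambda>t. \<Inter>s\<in>{t..}. fibre_at p s k y"
  have [measurable]: "fibre_at p s k y \<in> sets coin" for s
    using finitary_fibre_at by (rule sets_finitary)
  have "fibre p k y = (\<Union>t. ?F t)"
  proof (intro equalityI subsetI)
    fix x assume "x \<in> fibre p k y"
    then have "\<forall>\<^sub>F s in sequentially. \<forall>i\<in>{..<k}. sim p s x [i] = Suc (of_bool (y i))"
      by (intro eventually_ball_finite) (auto simp: fibre_def split del: split_of_bool intro!: sim_if_computes)
    then show "x \<in> (\<Union>t. ?F t)"
      by (auto simp: eventually_sequentially fibre_at_def split del: split_of_bool)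
  next
    fix x assume "x \<in> (\<Union>t. ?F t)"
    then obtain t where "x \<in> fibre_at p t k y" by auto
    then show "x \<in> fibre p k y" by (auto simp: fibre_at_def fibre_def intro!: computes_if_sim)
  qed
  moreover have "(\<lambda>t. measure coin (?F t)) \<longlonglongrightarrow> measure coin (\<Union>t. ?F t)"
    by (intro coin.P.finite_Lim_measure_incseq) (auto simp: incseq_def)
  ultimately have "\<forall>\<^sub>F t in sequentially. c < measure coin (?F t)"
    using c by (intro order_tendstoD(1)) auto
  then obtain t where "c < measure coin (?F t)" by (auto simp: eventually_sequentially)
  also have "\<dots> \<le> measure coin (fibre_at p t k y)"
    by (intro coin.P.finite_measure_mono) auto
  finally show "\<exists>s. c < measure coin (fibre_at p s k y)" ..
next
  assume "\<exists>s. c < measure coin (fibre_at p s k y)"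
  then obtain s where "c < measure coin (fibre_at p s k y)" ..
  also have "\<dots> \<le> measure coin (fibre p k y)"
  proof (intro coin.P.finite_measure_mono sets_fibre subsetI)
    fix x assume "x \<in> fibre_at p s k y"
    then show "x \<in> fibre p k y" by (auto simp: fibre_at_def fibre_def intro!: computes_if_sim)
  qed
  finally show "c < measure coin (fibre p k y)" .
qed

text \<open>
  A string belongs to the test as soon as its fibre is large enough at one stage \<open>s\<close>, which is decided
  by running the simulation on the \<open>2 ^ s\<close> oracle strings of length \<open>s\<close>.
\<close>

lemma uniformly_ce_dense_strings: "uniformly_ce (dense_strings p)"
proof -
  \<comment> \<open>In terms of codes \<open>c\<close> only: \<open>2 ^ Suc i \<le> c\<close> says that \<open>i\<close> is a position of the coded string.\<close>
  define Q where "Q s a c \<longleftrightarrow> (\<forall>i<c. 2 ^ Suc i \<le> c \<longrightarrow> sim p s (bit a) [i] = Suc (of_bool (bit c i)))"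
    for s a c :: nat
  define P where "P s n c \<longleftrightarrow> 2 ^ Suc n * 2 ^ s < (\<Sum>a<2 ^ s. of_bool (Q s a c)) * c" for s n c :: nat
  have sim: "computable 5 (\<lambda>ns. sim p (ns ! 2) (bit (ns ! 1)) [ns ! 0])"
    using computable_comp[of "[\<lambda>ns. ns ! 2, \<lambda>ns. ns ! 1, \<lambda>ns. ns ! 0]" 5
        "\<lambda>ns. sim p (ns ! 0) (bit (ns ! 1)) (drop 2 ns)"] computable_sim[of 1 p]
    by (simp add: computable_nth)
  have "decidable (Suc (Suc 3)) (\<lambda>ns. 2 ^ Suc (ns ! 0) \<le> ns ! 4 \<longrightarrow>
      sim p (ns ! 2) (bit (ns ! 1)) [ns ! 0] = Suc (of_bool (bit (ns ! 4) (ns ! 0))))"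
    using sim by (intro decidable_imp decidable_le decidable_eq computable_power_2 computable_Suc
        computable_nth decidable_bit[unfolded decidable_def]) auto
  then have "decidable (Suc 3) (\<lambda>ns. \<forall>i<ns ! 3. 2 ^ Suc ((i # ns) ! 0) \<le> (i # ns) ! 4 \<longrightarrow>
      sim p ((i # ns) ! 2) (bit ((i # ns) ! 1)) [(i # ns) ! 0]
        = Suc (of_bool (bit ((i # ns) ! 4) ((i # ns) ! 0))))"
    by (intro decidable_all_less computable_nth) auto
  then have Q: "decidable (Suc 3) (\<lambda>ns. Q (ns ! 1) (ns ! 0) (ns ! 3))"
    by (simp add: Q_def)
  then have "decidable 3 (\<lambda>ns. 2 ^ Suc (ns ! 1) * 2 ^ (ns ! 0)
      < (\<Sum>a<2 ^ (ns ! 0). of_bool (Q ((a # ns) ! 1) ((a # ns) ! 0) ((a # ns) ! 3))) * ns ! 2)"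
    by (intro decidable_less computable_mult computable_power_2 computable_Suc computable_nth
        computable_sum Q[unfolded decidable_def]) auto
  then have "decidable (Suc 2) (\<lambda>ns. P (ns ! 0) (ns ! 1) (ns ! 2))"
    by (simp add: P_def)
  then obtain q where q: "\<And>ns. length ns = 2 \<Longrightarrow>
      (\<exists>v. computes (\<lambda>_. False) q ns v) \<longleftrightarrow> (\<exists>s. P ((s # ns) ! 0) ((s # ns) ! 1) ((s # ns) ! 2))"
    by (rule semidecidable_ex) blast
  have "\<sigma> \<in> dense_strings p n \<longleftrightarrow> (\<exists>s. P s n (string_code \<sigma>))" for n \<sigma>
  proof -
    let ?c = "string_code \<sigma>" and ?F = "\<lambda>s. fibre_at p s (length \<sigma>) (\<lambda>i. \<sigma> ! i)"
    have pos: "0 < ?c" using string_code_bounds(1)[of \<sigma>] by (rule less_le_trans[rotated]) simp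
    have index: "i < ?c \<and> 2 ^ Suc i \<le> ?c \<longleftrightarrow> i < length \<sigma>" for i
    proof
      assume "i < ?c \<and> 2 ^ Suc i \<le> ?c"
      then have "(2 :: nat) ^ Suc i < 2 ^ Suc (length \<sigma>)"
        using string_code_bounds(2)[of \<sigma>] by linarith
      then show "i < length \<sigma>" by (subst (asm) power_strict_increasing_iff) auto
    next
      assume "i < length \<sigma>"
      then have "(2 :: nat) ^ Suc i \<le> 2 ^ length \<sigma>" by (intro power_increasing) auto
      with string_code_bounds(1)[of \<sigma>] have "2 ^ Suc i \<le> ?c" by linarith
      moreover have "i < 2 ^ Suc i" using less_exp[of "Suc i"] by linarith
      ultimately show "i < ?c \<and> 2 ^ Suc i \<le> ?c" by linarith
    qed
    have Q: "Q s a ?c \<longleftrightarrow> bit a \<in> ?F s" for s a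
    proof -
      have "Q s a ?c \<longleftrightarrow> (\<forall>i. i < ?c \<and> 2 ^ Suc i \<le> ?c \<longrightarrow> sim p s (bit a) [i] = Suc (of_bool (bit ?c i)))"
        unfolding Q_def by blast
      also have "\<dots> \<longleftrightarrow> bit a \<in> ?F s"
        unfolding index by (auto simp: fibre_at_def bit_string_code)
      finally show ?thesis .
    qed
    have P: "P s n ?c \<longleftrightarrow> 2 ^ Suc n / real ?c < measure coin (?F s)" for s
    proof -
      let ?m = "card {a :: nat. a < 2 ^ s \<and> bit a \<in> ?F s}"
      have "(\<Sum>a<2 ^ s. of_bool (Q s a ?c)) = ?m"
        unfolding Q by (simp add: sum.If_cases of_bool_def Int_def)
      then have "P s n ?c \<longleftrightarrow> 2 ^ Suc n * 2 ^ s < ?m * ?c" by (simp add: P_def)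
      also have "\<dots> \<longleftrightarrow> real (2 ^ Suc n * 2 ^ s) < real (?m * ?c)" by (rule of_nat_less_iff[symmetric])
      also have "\<dots> \<longleftrightarrow> 2 ^ Suc n / real ?c < real ?m / 2 ^ s"
        using pos by (simp add: field_simps)
      finally show ?thesis unfolding measure_finitary[OF finitary_fibre_at] .
    qed
    have "\<sigma> \<in> dense_strings p n \<longleftrightarrow> 2 ^ Suc n / real ?c < measure coin (fibre p (length \<sigma>) (\<lambda>i. \<sigma> ! i))"
      using pos by (simp add: dense_strings_def field_simps)
    also have "\<dots> \<longleftrightarrow> (\<exists>s. P s n ?c)" unfolding P by (rule less_measure_fibre_iff)
    finally show ?thesis .
  qed
  then show ?thesis
    unfolding uniformly_ce_def using q by (intro exI[of _ q]) simp
qed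

lemma sets_generated_open [measurable]: "generated_open S \<in> sets coin"
proof -
  have "generated_open S = (\<Union>k. {x. map x [0..<k] \<in> S})" by (auto simp: generated_open_def)
  moreover have "finitary k {x. map x [0..<k] \<in> S}" for k
  proof -
    have "map x [0..<k] = map y [0..<k]" if "\<forall>i<k. x i = y i" for x y :: cantor using that by simp
    then show ?thesis unfolding finitary_def by (metis mem_Collect_eq)
  qed
  ultimately show ?thesis using sets_finitary by auto
qed

text \<open>
  Kolmogorov's inequality. The minimal strings of the test generate the same open set
  and are pairwise incompatible, so both their cylinders and their fibres are disjoint; each
  cylinder has at most \<open>1 / 2 ^ n\<close> times the measure of the fibre, and the fibres have total measure at
  most 1.
\<close>

lemma emeasure_dense_strings:
  "emeasure coin (generated_open (dense_strings p n)) \<le> ennreal (1 / 2 ^ n)"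
proof -
  define S where "S = {\<sigma> \<in> dense_strings p n. \<forall>k<length \<sigma>. take k \<sigma> \<notin> dense_strings p n}"
  have ordered: "\<sigma> = \<tau>" if S: "\<sigma> \<in> S" "\<tau> \<in> S" and len: "length \<sigma> \<le> length \<tau>"
    and eq: "\<forall>i<length \<sigma>. \<sigma> ! i = \<tau> ! i" for \<sigma> \<tau>
  proof -
    have "\<sigma> = take (length \<sigma>) \<tau>" using len eq by (intro nth_equalityI) auto
    with S have "\<not> length \<sigma> < length \<tau>" unfolding S_def by auto
    with \<open>\<sigma> = take (length \<sigma>) \<tau>\<close> show ?thesis by simp
  qed
  have differ: "\<exists>i. i < length \<sigma> \<and> i < length \<tau> \<and> \<sigma> ! i \<noteq> \<tau> ! i"
    if "\<sigma> \<in> S" "\<tau> \<in> S" "\<sigma> \<noteq> \<tau>" for \<sigma> \<tau>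
  proof (rule ccontr)
    assume "\<not> ?thesis"
    then have "\<forall>i<length \<sigma>. i < length \<tau> \<longrightarrow> \<sigma> ! i = \<tau> ! i" by blast
    with that ordered[of \<sigma> \<tau>] ordered[of \<tau> \<sigma>] show False
      by (cases "length \<sigma> \<le> length \<tau>") auto
  qed
  let ?C = "\<lambda>\<sigma>. cylinder (length \<sigma>) (\<lambda>i. \<sigma> ! i)" and ?F = "\<lambda>\<sigma>. fibre p (length \<sigma>) (\<lambda>i. \<sigma> ! i)"
  have disj_C: "disjoint_family_on ?C S"
    unfolding disjoint_family_on_def
  proof (intro ballI impI equals0I)
    fix \<sigma> \<tau> x assume "\<sigma> \<in> S" "\<tau> \<in> S" "\<sigma> \<noteq> \<tau>" and x: "x \<in> ?C \<sigma> \<inter> ?C \<tau>"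
    then obtain i where "i < length \<sigma>" "i < length \<tau>" "\<sigma> ! i \<noteq> \<tau> ! i" using differ by blast
    with x show False by (auto simp: cylinder_def)
  qed
  have disj_F: "disjoint_family_on ?F S"
    unfolding disjoint_family_on_def
  proof (intro ballI impI equals0I)
    fix \<sigma> \<tau> x assume "\<sigma> \<in> S" "\<tau> \<in> S" "\<sigma> \<noteq> \<tau>" and x: "x \<in> ?F \<sigma> \<inter> ?F \<tau>"
    then obtain i where i: "i < length \<sigma>" "i < length \<tau>" "\<sigma> ! i \<noteq> \<tau> ! i" using differ by blast
    with x have "computes x p [i] (of_bool (\<sigma> ! i))" "computes x p [i] (of_bool (\<tau> ! i))"
      by (auto simp: fibre_def split del: split_of_bool)
    then have "of_bool (\<sigma> ! i) = (of_bool (\<tau> ! i) :: nat)" by (rule computes_unique)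
    with i(3) show False by (simp split: if_splits split_of_bool_asm)
  qed
  have S: "countable S" by (rule countableI_type)
  have "generated_open (dense_strings p n) = (\<Union>\<sigma>\<in>S. ?C \<sigma>)"
  proof (intro equalityI subsetI)
    fix x assume "x \<in> generated_open (dense_strings p n)"
    then have ex: "\<exists>k. map x [0..<k] \<in> dense_strings p n" by (simp add: generated_open_def)
    define k where "k = (LEAST k. map x [0..<k] \<in> dense_strings p n)"
    have "map x [0..<k] \<in> dense_strings p n" unfolding k_def by (rule LeastI_ex[OF ex])
    moreover have "map x [0..<j] \<notin> dense_strings p n" if "j < k" for j
      using not_less_Least that unfolding k_def by blast
    ultimately have "map x [0..<k] \<in> S" by (simp add: S_def take_map)
    then show "x \<in> (\<Union>\<sigma>\<in>S. ?C \<sigma>)" by (rule UN_I) (simp add: cylinder_def)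
  next
    fix x assume "x \<in> (\<Union>\<sigma>\<in>S. ?C \<sigma>)"
    then obtain \<sigma> where \<sigma>: "\<sigma> \<in> S" "x \<in> ?C \<sigma>" by blast
    then have "map x [0..<length \<sigma>] = \<sigma>" by (auto simp: cylinder_def intro: nth_equalityI)
    with \<sigma>(1) show "x \<in> generated_open (dense_strings p n)"
      unfolding generated_open_def S_def by (metis (mono_tags, lifting) mem_Collect_eq)
  qed
  then have "emeasure coin (generated_open (dense_strings p n))
      = (\<integral>\<^sup>+\<sigma>. emeasure coin (?C \<sigma>) \<partial>count_space S)"
    using emeasure_UN_countable[OF _ S disj_C] by simp
  also have "\<dots> \<le> (\<integral>\<^sup>+\<sigma>. ennreal (1 / 2 ^ n) * emeasure coin (?F \<sigma>) \<partial>count_space S)"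
  proof (intro nn_integral_mono)
    fix \<sigma> assume "\<sigma> \<in> space (count_space S)"
    then have "2 ^ Suc n < measure coin (?F \<sigma>) * real (string_code \<sigma>)"
      by (simp add: S_def dense_strings_def)
    also have "\<dots> \<le> measure coin (?F \<sigma>) * 2 ^ Suc (length \<sigma>)"
    proof (intro mult_left_mono)
      have "real (string_code \<sigma>) \<le> real (2 ^ Suc (length \<sigma>))"
        using string_code_bounds(2)[of \<sigma>] by (intro of_nat_mono) simp
      then show "real (string_code \<sigma>) \<le> 2 ^ Suc (length \<sigma>)" by simp
    qed simp
    finally have "1 / 2 ^ length \<sigma> \<le> 1 / 2 ^ n * measure coin (?F \<sigma>)"
      by (simp add: field_simps)
    then show "emeasure coin (?C \<sigma>) \<le> ennreal (1 / 2 ^ n) * emeasure coin (?F \<sigma>)"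
      unfolding emeasure_cylinder coin.P.emeasure_eq_measure[of "?F \<sigma>"]
      by (simp add: ennreal_mult'[symmetric] ennreal_leI)
  qed
  also have "\<dots> = ennreal (1 / 2 ^ n) * emeasure coin (\<Union>\<sigma>\<in>S. ?F \<sigma>)"
    using emeasure_UN_countable[OF _ S disj_F, of coin] by (simp add: nn_integral_cmult)
  also have "\<dots> \<le> ennreal (1 / 2 ^ n) * 1"
    by (intro mult_left_mono coin.P.emeasure_le_1) auto
  finally show ?thesis by simp
qed

lemma emeasure_mu: "A \<in> sets coin \<Longrightarrow> emeasure \<mu> A = emeasure coin A"
  by (simp add: \<mu>_def)

lemma martin_loef_test_dense_strings: "martin_loef_test (dense_strings p)"
  unfolding martin_loef_test_def
  using uniformly_ce_dense_strings emeasure_dense_strings by (simp add: emeasure_mu)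

section \<open>Preimages of null sets\<close>

instance program :: countable
  by countable_datatype

text \<open>There are only countably many tests, as each is enumerated by a program.\<close>

lemma null_nonrandom: "{x. \<not> martin_loef_random x} \<in> null_sets \<mu>"
proof -
  let ?V = "\<lambda>p n. {\<sigma>. \<exists>v. computes (\<lambda>_. False) p [n, string_code \<sigma>] v}"
  let ?T = "{p. martin_loef_test (?V p)}"
  have "(\<Inter>n. generated_open (V n)) \<in> null_sets coin" if V: "martin_loef_test V" for V
  proof -
    have "emeasure coin (\<Inter>n. generated_open (V n)) \<le> ennreal (1 / 2 ^ n)" for n
      using V emeasure_mono[of "\<Inter>n. generated_open (V n)" "generated_open (V n)" coin]
      by (fastforce simp: martin_loef_test_def emeasure_mu intro: order_trans)
    then have "measure coin (\<Inter>n. generated_open (V n)) \<le> (1 / 2) ^ n" for n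
      by (simp add: coin.P.emeasure_eq_measure power_one_over)
    then have "measure coin (\<Inter>n. generated_open (V n)) \<le> 0"
      by (intro LIMSEQ_le_const[OF LIMSEQ_realpow_zero[of "1 / 2"]]) auto
    then show ?thesis
      by (simp add: null_sets_def coin.P.emeasure_eq_measure measure_le_0_iff)
  qed
  then have "(\<Union>p\<in>?T. \<Inter>n. generated_open (?V p n)) \<in> null_sets coin"
    by (intro null_sets_UN' countableI_type) auto
  moreover have "{x. \<not> martin_loef_random x} \<subseteq> (\<Union>p\<in>?T. \<Inter>n. generated_open (?V p n))"
  proof
    fix x assume "x \<in> {x. \<not> martin_loef_random x}"
    then obtain V where V: "martin_loef_test V" "x \<in> (\<Inter>n. generated_open (V n))"
      by (auto simp: martin_loef_random_def)
    from V(1) obtain p where p: "\<forall>n \<sigma>. \<sigma> \<in> V n \<longleftrightarrow> (\<exists>v. computes (\<lambda>_. False) p [n, string_code \<sigma>] v)"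
      by (auto simp: martin_loef_test_def uniformly_ce_def)
    then have "V = ?V p" by blast
    with V show "x \<in> (\<Union>p\<in>?T. \<Inter>n. generated_open (?V p n))" by blast
  qed
  ultimately show ?thesis
    unfolding \<mu>_def null_sets_completion_iff2 by blast
qed

text \<open>
  A random point of the domain has a random value, which escapes the test of the program at some level
  \<open>n\<close>; let \<open>D n\<close> be the part of the domain where this happens. If the value of some point of \<open>D n\<close>
  lies in a cylinder, then the string of the cylinder is a prefix of this value and so not in the test,
  which bounds the measure of the points that are mapped to the cylinder. Thus the image of the measure
  on \<open>D n\<close> is controlled by the uniform measure.
\<close>

lemma null_sets_result_vimage:
  assumes total: "\<And>x n. x \<in> domain_of p \<Longrightarrow> computes x p [n] (of_bool (result p x n))"
    and random: "\<And>x. x \<in> domain_of p \<Longrightarrow> martin_loef_random x \<Longrightarrow> martin_loef_random (result p x)"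
    and N: "N \<in> null_sets coin"
  shows "{x \<in> domain_of p. result p x \<in> N} \<in> null_sets coin"
proof -
  let ?G = "\<lambda>n. generated_open (dense_strings p n)"
  define D where "D n = {x \<in> domain_of p. result p x \<notin> ?G n}" for n
  have sets_vimage: "{x \<in> domain_of p. result p x \<in> A} \<in> sets coin" if "A \<in> sets coin" for A
  proof -
    have "result p -` A \<inter> space coin \<inter> domain_of p \<in> sets coin" using that by measurable
    also have "result p -` A \<inter> space coin \<inter> domain_of p = {x \<in> domain_of p. result p x \<in> A}" by auto
    finally show ?thesis .
  qed
  have D [measurable]: "D n \<in> sets coin" for n
    using sets_vimage[of "- ?G n"] sets.compl_sets[OF sets_generated_open, of "dense_strings p n"]
    by (simp add: D_def Compl_eq_Diff_UNIV)
  have bounded: "{x \<in> D n. result p x \<in> N} \<in> null_sets coin" for n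
  proof -
    let ?M = "distr (density coin (indicator (D n))) coin (result p)"
    have result: "result p \<in> density coin (indicator (D n)) \<rightarrow>\<^sub>M coin" by simp
    have M: "emeasure ?M A = emeasure coin {x \<in> D n. result p x \<in> A}" if A [measurable]: "A \<in> sets coin" for A
    proof -
      have "emeasure ?M A = emeasure (density coin (indicator (D n))) (result p -` A \<inter> space coin)"
        using A by (subst emeasure_distr[OF result]) simp_all
      also have "\<dots> = emeasure coin (D n \<inter> (result p -` A \<inter> space coin))"
        by (rule emeasure_restricted) measurable
      also have "D n \<inter> (result p -` A \<inter> space coin) = {x \<in> D n. result p x \<in> A}" by auto
      finally show ?thesis .
    qed
    have "N \<in> null_sets ?M"
    proof (rule null_sets_if_cylinder_bound[OF _ _ _ N])
      show "finite_measure ?M"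
        by (rule finite_measureI) (simp add: M[OF sets.top[of coin, simplified]])
      fix k y
      have "measure coin {x \<in> D n. result p x \<in> cylinder k y} \<le> 2 ^ Suc n * (1 / 2 ^ k)"
      proof (cases "\<exists>x \<in> D n. result p x \<in> cylinder k y")
        case True
        then obtain x where x: "x \<in> D n" "result p x \<in> cylinder k y" by blast
        define \<sigma> where "\<sigma> = map y [0..<k]"
        have "\<sigma> = map (result p x) [0..<k]" using x(2) by (simp add: cylinder_def \<sigma>_def)
        with x(1) have "\<sigma> \<notin> dense_strings p n" by (auto simp: D_def generated_open_def)
        then have "measure coin (fibre p k (\<lambda>i. \<sigma> ! i)) * real (string_code \<sigma>) \<le> 2 ^ Suc n"
          by (simp add: dense_strings_def \<sigma>_def)
        moreover have "2 ^ k \<le> real (string_code \<sigma>)"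
          using string_code_bounds(1)[of \<sigma>, THEN of_nat_mono, where 'a = real] by (simp add: \<sigma>_def)
        ultimately have "measure coin (fibre p k (\<lambda>i. \<sigma> ! i)) * 2 ^ k \<le> 2 ^ Suc n"
          by (meson measure_nonneg mult_left_mono order_trans)
        moreover have "measure coin {x \<in> D n. result p x \<in> cylinder k y} \<le> measure coin (fibre p k (\<lambda>i. \<sigma> ! i))"
        proof (intro coin.P.finite_measure_mono sets_fibre subsetI)
          fix z assume z: "z \<in> {x \<in> D n. result p x \<in> cylinder k y}"
          have "computes z p [i] (of_bool (\<sigma> ! i))" if "i < k" for i
          proof -
            have "result p z i = \<sigma> ! i" using z that by (simp add: cylinder_def \<sigma>_def)
            moreover have "computes z p [i] (of_bool (result p z i))"
              using z by (intro total) (simp add: D_def)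
            ultimately show ?thesis by (simp only:)
          qed
          then show "z \<in> fibre p k (\<lambda>i. \<sigma> ! i)" by (simp only: fibre_def mem_Collect_eq) blast
        qed
        ultimately have "measure coin {x \<in> D n. result p x \<in> cylinder k y} * 2 ^ k \<le> 2 ^ Suc n"
          by (meson mult_right_mono order_trans zero_le_numeral zero_le_power)
        then show ?thesis by (simp add: field_simps)
      next
        case False
        then have "{x \<in> D n. result p x \<in> cylinder k y} = {}" by blast
        then have "measure coin {x \<in> D n. result p x \<in> cylinder k y} = 0" by (simp only: measure_empty)
        then show ?thesis by simp
      qed
      then show "measure ?M (cylinder k y) \<le> 2 ^ Suc n * measure coin (cylinder k y)"
        unfolding measure_def M[OF sets_cylinder] emeasure_cylinder by simp
    qed simp
    moreover have "{x \<in> D n. result p x \<in> N} \<in> sets coin"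
    proof -
      have "D n \<inter> {x \<in> domain_of p. result p x \<in> N} \<in> sets coin"
        using N by (intro sets.Int D sets_vimage) auto
      also have "D n \<inter> {x \<in> domain_of p. result p x \<in> N} = {x \<in> D n. result p x \<in> N}" by (auto simp: D_def)
      finally show ?thesis .
    qed
    ultimately show ?thesis using M[of N] N by (simp add: null_sets_def)
  qed
  have "{x \<in> domain_of p. result p x \<in> N}
      \<subseteq> (\<Union>n. {x \<in> D n. result p x \<in> N}) \<union> {x. \<not> martin_loef_random x}"
  proof
    fix x assume x: "x \<in> {x \<in> domain_of p. result p x \<in> N}"
    show "x \<in> (\<Union>n. {x \<in> D n. result p x \<in> N}) \<union> {x. \<not> martin_loef_random x}"
    proof (cases "martin_loef_random x")
      case True
      with x have "martin_loef_random (result p x)" using random by blast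
      then obtain n where "result p x \<notin> ?G n"
        using martin_loef_test_dense_strings by (auto simp: martin_loef_random_def)
      with x show ?thesis by (auto simp: D_def)
    qed simp
  qed
  moreover have "(\<Union>n. {x \<in> D n. result p x \<in> N}) \<union> {x. \<not> martin_loef_random x} \<in> null_sets \<mu>"
    using null_sets_UN[of "\<lambda>n. {x \<in> D n. result p x \<in> N}" coin] bounded null_nonrandom
    by (intro null_sets.Un) (simp_all add: \<mu>_def null_sets_completionI)
  ultimately have "{x \<in> domain_of p. result p x \<in> N} \<in> null_sets \<mu>"
    unfolding \<mu>_def by (rule null_sets_completion_subset)
  moreover have "{x \<in> domain_of p. result p x \<in> N} \<in> sets coin" using N by (intro sets_vimage) auto
  ultimately show ?thesis by (simp add: \<mu>_def null_sets_completion_iff)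
qed

section \<open>Joining reals, and the theorem\<close>

lemma join_nth [simp]: "(x \<oplus> y) (2 * n) = x n" "(x \<oplus> y) (Suc (2 * n)) = y n"
  by (simp_all add: join_def)

lemma measurable_nth: "(\<lambda>x. x n) \<in> coin \<rightarrow>\<^sub>M uniform_count_measure UNIV"
  by (rule measurable_component_singleton) simp

lemma measurable_join [measurable (raw)]:
  assumes [measurable]: "f \<in> M \<rightarrow>\<^sub>M coin" "g \<in> M \<rightarrow>\<^sub>M coin"
  shows "(\<lambda>x. f x \<oplus> g x) \<in> M \<rightarrow>\<^sub>M coin"
  unfolding join_def
proof (rule measurable_PiM_single')
  fix n :: nat
  have "(\<lambda>x. f x m) \<in> M \<rightarrow>\<^sub>M uniform_count_measure UNIV" "(\<lambda>x. g x m) \<in> M \<rightarrow>\<^sub>M uniform_count_measure UNIV" for m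
    using measurable_compose[OF assms(1) measurable_nth] measurable_compose[OF assms(2) measurable_nth] by auto
  then show "(\<lambda>x. if even n then f x (n div 2) else g x (n div 2)) \<in> M \<rightarrow>\<^sub>M uniform_count_measure UNIV"
    by (cases "even n") simp_all
qed (simp add: space_uniform_count_measure)

interpretation coin2: pair_prob_space coin coin ..

text \<open>
  Clopen sets that depend on \<open>k\<close> bits also depend on \<open>2 * k\<close> bits, and a cylinder of even length
  corresponds to a rectangle of two cylinders. The second component of the join comes first in the pair
  because the sections of interest fix it.
\<close>

lemma distr_join: "distr (coin \<Otimes>\<^sub>M coin) coin (\<lambda>(r, x). x \<oplus> r) = coin" (is "?M = _")
proof (rule measure_eqI_generator_eq[where E = "{A. \<exists>k. finitary k A}" and \<Omega> = UNIV and A = "\<lambda>_. UNIV"])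
  show "Int_stable {A. \<exists>k. finitary k A}"
  proof (rule Int_stableI)
    fix A B assume "A \<in> {A. \<exists>k. finitary k A}" "B \<in> {A. \<exists>k. finitary k A}"
    then obtain k l where "finitary k A" "finitary l B" by blast
    then have "finitary (max k l) A" "finitary (max k l) B" by (auto intro: finitary_mono)
    from finitaryD[OF this(1)] finitaryD[OF this(2)] have "finitary (max k l) (A \<inter> B)"
      unfolding finitary_def by blast
    then show "A \<inter> B \<in> {A. \<exists>k. finitary k A}" by blast
  qed
  fix A assume "A \<in> {A. \<exists>k. finitary k A}"
  then obtain k where "finitary k A" by blast
  then have A: "finitary (2 * k) A" by (rule finitary_mono) simp
  have "emeasure ?M (cylinder (2 * k) y) = emeasure coin (cylinder (2 * k) y)" for y
  proof -
    let ?e = "\<lambda>n. y (2 * n)" and ?o = "\<lambda>n. y (Suc (2 * n))"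
    have iff: "x \<oplus> r \<in> cylinder (2 * k) y \<longleftrightarrow> x \<in> cylinder k ?e \<and> r \<in> cylinder k ?o" for x r
    proof
      assume *: "x \<oplus> r \<in> cylinder (2 * k) y"
      have "x i = y (2 * i)" "r i = y (Suc (2 * i))" if "i < k" for i
      proof -
        have "2 * i < 2 * k" "Suc (2 * i) < 2 * k" using that by simp_all
        with * have "(x \<oplus> r) (2 * i) = y (2 * i)" "(x \<oplus> r) (Suc (2 * i)) = y (Suc (2 * i))"
          unfolding cylinder_def by blast+
        then show "x i = y (2 * i)" "r i = y (Suc (2 * i))" by simp_all
      qed
      then show "x \<in> cylinder k ?e \<and> r \<in> cylinder k ?o" by (simp add: cylinder_def)
    next
      assume *: "x \<in> cylinder k ?e \<and> r \<in> cylinder k ?o"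
      have "(x \<oplus> r) i = y i" if "i < 2 * k" for i
        using that * by (cases "even i") (auto simp: cylinder_def elim!: evenE oddE)
      then show "x \<oplus> r \<in> cylinder (2 * k) y" by (simp add: cylinder_def)
    qed
    have "emeasure ?M (cylinder (2 * k) y)
        = emeasure (coin \<Otimes>\<^sub>M coin) ((\<lambda>(r, x). x \<oplus> r) -` cylinder (2 * k) y \<inter> space (coin \<Otimes>\<^sub>M coin))"
      by (rule emeasure_distr) measurable
    also have "(\<lambda>(r, x). x \<oplus> r) -` cylinder (2 * k) y \<inter> space (coin \<Otimes>\<^sub>M coin) = cylinder k ?o \<times> cylinder k ?e"
      by (auto simp: iff space_pair_measure)
    also have "emeasure (coin \<Otimes>\<^sub>M coin) \<dots> = ennreal (1 / 2 ^ k) * ennreal (1 / 2 ^ k)"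
      by (simp add: coin.P.emeasure_pair_measure_Times sets_cylinder emeasure_cylinder)
    also have "\<dots> = ennreal (1 / 2 ^ (2 * k))"
      by (simp add: ennreal_mult'[symmetric] mult_2 power_add)
    finally show ?thesis by (simp add: emeasure_cylinder)
  qed
  then show "emeasure ?M A = emeasure coin A"
    by (simp add: emeasure_finitary[OF A])
next
  have "finitary 0 UNIV" by (simp add: finitary_def)
  then show "range (\<lambda>_. UNIV) \<subseteq> {A. \<exists>k. finitary k A}" by auto
  show "emeasure ?M UNIV \<noteq> \<infinity>" 
  proof -
    interpret prob_space ?M by (rule coin2.P.prob_space_distr) simp
    show ?thesis using emeasure_finite[of UNIV] by simp
  qed
qed (auto simp: sets_coin_eq)

lemma AE_coin_iff_AE_join:
  assumes "{z. P z} \<in> sets coin"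
  shows "(AE z in coin. P z) \<longleftrightarrow> (AE r in coin. AE x in coin. P (x \<oplus> r))"
proof -
  have [measurable]: "Measurable.pred coin P" using assms by (simp add: pred_def)
  have "(AE z in coin. P z) \<longleftrightarrow> (AE z in distr (coin \<Otimes>\<^sub>M coin) coin (\<lambda>(r, x). x \<oplus> r). P z)"
    by (simp only: distr_join)
  also have "\<dots> \<longleftrightarrow> (AE w in coin \<Otimes>\<^sub>M coin. P (snd w \<oplus> fst w))"
    using assms by (subst AE_distr_iff) (simp_all add: split_beta)
  also have "\<dots> \<longleftrightarrow> (AE r in coin. AE x in coin. P (x \<oplus> r))"
    by (rule coin2.AE_pair_iff[symmetric, of "\<lambda>r x. P (x \<oplus> r)"]) measurable
  finally show ?thesis .
qed

text \<open>
  Being null for the completed measure, the set of those \<open>y \<oplus> r\<close> on which \<open>g\<close> succeeds has a Borel null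
  superset \<open>R\<close>. Its preimage \<open>?L\<close> under \<open>x \<oplus> r \<mapsto> f x \<oplus> r\<close> is shown to be null section by section.
\<close>

theorem theorem3p6:
  fixes f :: "cantor \<rightharpoonup> cantor"
  assumes "partial_computable f"
    and "random_preserving f"
    and "right_oneway f"
  shows "left_oneway f"
  unfolding left_oneway_def
proof (intro conjI allI impI)
  show "partial_computable f" by fact
  show "0 < emeasure \<mu> (dom f)" using assms(2) by (simp add: random_preserving_def)
  from assms(1) obtain p where
    dom: "\<And>x. x \<in> dom f \<longleftrightarrow> (\<forall>n. \<exists>v. computes x p [n] v)" and
    val: "\<And>x y n. f x = Some y \<Longrightarrow> computes x p [n] (of_bool (y n))"
    unfolding partial_computable_def by blast
  have f: "y = result p x" if "f x = Some y" for x y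
  proof
    fix n
    have "computes x p [n] 1 \<Longrightarrow> of_bool (y n) = (1 :: nat)"
      using val[OF that] by (rule computes_unique)
    with val[OF that, of n] show "y n = result p x n"
      by (cases "y n") (auto simp: result_def)
  qed
  have f_result: "f x = Some (result p x)" if "x \<in> domain_of p" for x
    using that dom[of x] f[of x] by (auto simp: domain_of_def)
  fix g assume "partial_computable g"
  with assms(3) have "{y \<oplus> r |y r. \<exists>z. g (y \<oplus> r) = Some z \<and> f z = Some y} \<in> null_sets \<mu>"
    by (simp add: right_oneway_def)
  then obtain R where R: "R \<in> null_sets coin"
    and sub: "{y \<oplus> r |y r. \<exists>z. g (y \<oplus> r) = Some z \<and> f z = Some y} \<subseteq> R"
    unfolding \<mu>_def null_sets_completion_iff2 by blast
  let ?L = "{z. (\<lambda>n. z (2 * n)) \<in> domain_of p \<and> result p (\<lambda>n. z (2 * n)) \<oplus> (\<lambda>n. z (Suc (2 * n))) \<in> R}"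
  have half [measurable]: "(\<lambda>z n. z (h n)) \<in> coin \<rightarrow>\<^sub>M coin" for h
    by (rule measurable_PiM_single') (simp_all add: measurable_nth space_uniform_count_measure)
  have [measurable]: "R \<in> sets coin" using R by auto
  have L: "?L \<in> sets coin"
  proof -
    have "{z \<in> space coin. (\<lambda>n. z (2 * n)) \<in> domain_of p \<and> result p (\<lambda>n. z (2 * n)) \<oplus> (\<lambda>n. z (Suc (2 * n))) \<in> R} \<in> sets coin"
      by measurable
    then show ?thesis by simp
  qed
  have "AE z in coin. z \<notin> R" using R by (rule AE_not_in)
  then have "AE r in coin. AE y in coin. y \<oplus> r \<notin> R"
    using AE_coin_iff_AE_join[of "\<lambda>z. z \<notin> R"] sets.compl_sets[OF \<open>R \<in> sets coin\<close>]
    by (simp add: set_diff_eq)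
  then have "AE r in coin. AE x in coin. x \<oplus> r \<notin> ?L"
  proof eventually_elim
    case (elim r)
    have "{y. y \<oplus> r \<in> R} \<in> sets coin"
    proof -
      have "{y \<in> space coin. y \<oplus> r \<in> R} \<in> sets coin" by measurable
      then show ?thesis by simp
    qed
    with elim have "{y. y \<oplus> r \<in> R} \<in> null_sets coin"
      by (subst (asm) AE_iff_null) (simp_all)
    then have "{x \<in> domain_of p. result p x \<in> {y. y \<oplus> r \<in> R}} \<in> null_sets coin"
    proof (rule null_sets_result_vimage[rotated 2])
      fix x assume x: "x \<in> domain_of p"
      show "computes x p [n] (of_bool (result p x n))" for n
        using val f_result[OF x] by blast
      show "martin_loef_random x \<Longrightarrow> martin_loef_random (result p x)"
        using assms(2) f_result[OF x] unfolding random_preserving_def by blast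
    qed
    from AE_not_in[OF this] show ?case by eventually_elim simp
  qed
  then have "AE z in coin. z \<notin> ?L"
    using AE_coin_iff_AE_join[of "\<lambda>z. z \<notin> ?L"] sets.compl_sets[OF L] by (simp add: set_diff_eq)
  with L have "?L \<in> null_sets coin"
    by (subst (asm) AE_iff_null) (simp_all)
  moreover have "{x \<oplus> r |x r. \<exists>y z. f x = Some y \<and> g (y \<oplus> r) = Some z \<and> f z = Some y} \<subseteq> ?L"
  proof
    fix w assume "w \<in> {x \<oplus> r |x r. \<exists>y z. f x = Some y \<and> g (y \<oplus> r) = Some z \<and> f z = Some y}"
    then obtain x r y z where w: "w = x \<oplus> r" "f x = Some y" "g (y \<oplus> r) = Some z" "f z = Some y"
      by blast
    then have "y \<oplus> r \<in> R" using sub by blast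
    with w f[of x y] dom[of x] show "w \<in> ?L" by (auto simp: domain_of_def)
  qed
  ultimately show "{x \<oplus> r |x r. \<exists>y z. f x = Some y \<and> g (y \<oplus> r) = Some z \<and> f z = Some y} \<in> null_sets \<mu>"
    unfolding \<mu>_def null_sets_completion_iff2 by blast
qed

end
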